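(* Let $\Gamma$ be a graph, let $\Gamma'\leq\Gamma$ be a subgraph of $\Gamma$ with at least one edge, and let $v$ be a positive integer such that there exists a $(K_v,\Gamma)$-design. Then the sets $\mathcal{L}_1\Gamma(v)$ and $\mathcal{L}_2\Gamma(v)$ (defined with respect to $\Gamma'$) are both non-empty.
   Context: All graphs are finite and simple; $\Gamma\leq K$ means $\Gamma$ is a subgraph of $K$ (or is isomorphic to one, when $\Gamma$ is an abstract graph). For a graph $K$ and $\Gamma\leq K$, a $(K,\Gamma)$-design is a set $\mathcal{B}$ of subgraphs of $K$, called blocks, each isomorphic to $\Gamma$, whose edge-sets partition $E(K)$. $K_n$ is the complete graph on a set of $n$ vertices (any $n$-element vertex set may be used); a $\Gamma$-design of order $n$ is a $(K_n,\Gamma)$-design. Given $\Gamma'\leq\Gamma$, a $(K,\Gamma)$-design $\mathcal{B}$ and a $(K',\Gamma')$-design $\mathcal{B}'$, a down-link from $\mathcal{B}$ to $\mathcal{B}'$ is a function $f:\mathcal{B}\to\mathcal{B}'$ such that $f(B)$ is a subgraph of $B$ for every $B\in\mathcal{B}$ (the vertex sets of $K$ and $K'$ need not coincide, and either may be the larger). For fixed $\Gamma'\leq\Gamma$ and $v$ such that a $(K_v,\Gamma)$-design exists: $\mathcal{L}_1\Gamma(v)$ is the set of all integers $n$ such that some $\Gamma$-design of order $v$ can be down-linked to a $\Gamma'$-design of order $n$; $\mathcal{L}_2\Gamma(v)$ is the set of all integers $n$ such that every $\Gamma$-design of order $v$ can be down-linked to a $\Gamma'$-design of order $n$. *)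

theory Defs
  imports
    "HOL-Library.FuncSet"
    "HOL-Library.Disjoint_Sets"
    "HOL-Library.Infinite_Typeclass"
    "Graph_Theory.Graph_Theory"
begin

text \<open>
  A finite simple graph is a \<^locale>\<open>pair_graph\<close>: a finite vertex set together with a symmetric,
  irreflexive set of vertex pairs, the edge \<open>{x, y}\<close> being represented by the two arcs \<open>(x, y)\<close> and
  \<open>(y, x)\<close>. All arc sets below are symmetric, so arc sets are disjoint, or cover \<open>parcs K\<close>, exactly
  when the corresponding sets of undirected edges do.
\<close>

text \<open>
  \<open>\<Gamma>' \<le> \<Gamma>\<close> for abstract graphs: \<open>\<Gamma>'\<close> is isomorphic to a subgraph of \<open>\<Gamma>\<close>
  (in particular it may itself be a subgraph of \<open>\<Gamma>\<close>).
\<close>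
definition graph_le :: "'b pair_pre_digraph \<Rightarrow> 'a pair_pre_digraph \<Rightarrow> bool" where
  "graph_le \<Gamma>' \<Gamma> \<longleftrightarrow> (\<exists>H :: 'a pair_pre_digraph. pair_graph H \<and>
     subgraph (with_proj H) (with_proj \<Gamma>) \<and> digraph_iso (with_proj H) (with_proj \<Gamma>'))"

definition graph_design ::
    "'v pair_pre_digraph \<Rightarrow> 'a pair_pre_digraph \<Rightarrow> 'v pair_pre_digraph set \<Rightarrow> bool" where
  "graph_design K \<Gamma> \<B> \<longleftrightarrow>
     (\<forall>B\<in>\<B>. pair_graph B \<and> subgraph (with_proj B) (with_proj K) \<and>
        digraph_iso (with_proj B) (with_proj \<Gamma>)) \<and>
     disjoint_family_on parcs \<B> \<and> (\<Union>B\<in>\<B>. parcs B) = parcs K"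

text \<open>
  Any \<open>n\<close>-element set of vertices may carry the complete graph. The null graph, which the library
  admits as complete graph on \<open>0\<close> vertices, is excluded.
\<close>
definition design_of_order ::
    "nat \<Rightarrow> 'a pair_pre_digraph \<Rightarrow> 'v pair_pre_digraph set \<Rightarrow> bool" where
  "design_of_order n \<Gamma> \<B> \<longleftrightarrow>
     0 < n \<and> (\<exists>K :: 'v pair_pre_digraph. complete_digraph n (with_proj K) \<and> graph_design K \<Gamma> \<B>)"

definition down_link ::
    "('v pair_pre_digraph \<Rightarrow> 'v pair_pre_digraph) \<Rightarrow>
     'v pair_pre_digraph set \<Rightarrow> 'v pair_pre_digraph set \<Rightarrow> bool" where
  "down_link f \<B> \<B>' \<longleftrightarrow> f \<in> \<B> \<rightarrow> \<B>' \<and> (\<forall>B\<in>\<B>. subgraph (with_proj (f B)) (with_proj B))"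

text \<open>
  The vertices of all designs are drawn from a common universe \<open>'v\<close>, since a down-link compares
  blocks of two designs as subgraphs. The universe is infinite so that it never limits the vertex
  sets available for either design.
\<close>
definition L1 ::
    "'v::infinite itself \<Rightarrow> 'b pair_pre_digraph \<Rightarrow> 'a pair_pre_digraph \<Rightarrow> nat \<Rightarrow> nat set" where
  "L1 U \<Gamma>' \<Gamma> v = {n. \<exists>(\<B> :: 'v pair_pre_digraph set) \<B>' f.
     design_of_order v \<Gamma> \<B> \<and> design_of_order n \<Gamma>' \<B>' \<and> down_link f \<B> \<B>'}"

definition L2 ::
    "'v::infinite itself \<Rightarrow> 'b pair_pre_digraph \<Rightarrow> 'a pair_pre_digraph \<Rightarrow> nat \<Rightarrow> nat set" where
  "L2 U \<Gamma>' \<Gamma> v = {n. \<forall>\<B> :: 'v pair_pre_digraph set. design_of_order v \<Gamma> \<B> \<longrightarrow>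
     (\<exists>\<B>' f. design_of_order n \<Gamma>' \<B>' \<and> down_link f \<B> \<B>')}"

end

theory Submission
  imports Defs "HOL-Number_Theory.Number_Theory"
begin

text \<open>
  Choosing in every block of the given design a copy of \<open>\<Gamma>'\<close> gives a set \<open>P\<close> of edge-disjoint copies on
  \<open>v\<close> vertices, and a \<open>\<Gamma>'\<close>-design containing \<open>P\<close> receives a down-link. Let \<open>m\<close> be the number of edges
  of \<open>P\<close> and let \<open>p\<close> be a prime with \<open>2 * m\<close> dividing \<open>p - 1\<close>. If the vertices are placed in the field
  of \<open>p\<close> elements so that the differences along the \<open>m\<close> edges lie in distinct cosets of the \<open>m\<close>-th
  powers, then the images of \<open>P\<close> under all maps \<open>x \<mapsto> a x + b\<close>, with \<open>a\<close> an \<open>m\<close>-th power taken up to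
  sign, form a \<open>\<Gamma>'\<close>-design of order \<open>p\<close>. For large \<open>p\<close> such a placement is found greedily, by a second
  moment estimate for the cosets. Both requirements on \<open>p\<close> can be met for all designs of order \<open>v\<close> at
  once because \<open>m \<le> 2 ^ v\<close>.
\<close>

section \<open>Primes congruent to 1\<close>

text \<open>If \<open>p\<close> divides \<open>a ^ j - 1\<close>, then \<open>a ^ k - 1\<close> is
  \<open>a ^ j - 1\<close> times a sum of \<open>k div j\<close> powers of \<open>a ^ j\<close>,
  each congruent to 1 modulo \<open>p\<close>. That sum is congruent to \<open>k div j\<close>,
  which is prime to \<open>p\<close>: a prime dividing \<open>k\<close> divides \<open>a\<close>, so
  it cannot divide \<open>a ^ k - 1\<close>.\<close>

lemma multiplicity_power_minus_one:
  fixes a j k p :: nat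
  assumes "prime p" "k dvd a" "j dvd k" "k > 0" "a \<ge> 2"
  shows "multiplicity p (a ^ j - 1) = (if ord p a dvd j then multiplicity p (a ^ k - 1) else 0)"
proof (cases "ord p a dvd j")
  case False
  have "a ^ j \<ge> 1" using assms(5) by simp
  hence "\<not> p dvd a ^ j - 1"
    using False by (metis ord_divides cong_altdef_nat cong_sym)
  thus ?thesis using False by (simp add: not_dvd_imp_multiplicity_0)
next
  case True
  obtain l where l: "k = j * l" using assms(3) by blast
  have "j > 0" using l assms(4) by auto
  have cj: "[a ^ j = 1] (mod p)" using True ord_divides[of a j p] by simp
  have "[a ^ k = 1] (mod p)" using cong_pow[OF cj, of l] by (simp add: l power_mult)
  have pk: "\<not> p dvd k"
  proof
    assume "p dvd k"
    hence "p dvd a ^ k" using assms(2,4) by (meson dvd_power dvd_trans)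
    with \<open>[a ^ k = 1] (mod p)\<close> have "p dvd 1" by (meson cong_dvd_iff)
    thus False using assms(1) by simp
  qed
  define b where "b = a ^ j"
  have "b \<ge> 1" using assms(5) by (simp add: b_def)
  define s where "s = (\<Sum>i<l. b ^ i)"
  have "int (b ^ l - 1) = int ((b - 1) * s)"
    using \<open>b \<ge> 1\<close> power_diff_1_eq[of "int b" l] by (simp add: s_def of_nat_diff)
  hence "b ^ l - 1 = (b - 1) * s" by (simp only: of_nat_eq_iff)
  hence fac: "a ^ k - 1 = (a ^ j - 1) * s" by (simp add: b_def l power_mult)
  have "[s = (\<Sum>i<l. 1)] (mod p)"
    unfolding s_def by (intro cong_sum) (use cong_pow[OF cj] in \<open>fastforce simp: b_def\<close>)
  hence "[s = l] (mod p)" by simp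
  hence ps: "\<not> p dvd s" using pk l by (metis cong_dvd_iff dvd_mult)
  have "a ^ j \<noteq> 1" using \<open>j > 0\<close> assms(5) by simp
  hence "a ^ j - 1 \<noteq> 0" using \<open>b \<ge> 1\<close> b_def by linarith
  moreover have "s \<noteq> 0" using ps by (metis dvd_0_right)
  ultimately have "multiplicity p (a ^ k - 1) = multiplicity p (a ^ j - 1) + multiplicity p s"
    unfolding fac using assms(1) by (intro prime_elem_multiplicity_mult_distrib) auto
  with True ps show ?thesis by (simp add: not_dvd_imp_multiplicity_0)
qed

text \<open>Adding or removing \<open>r\<close> is an involution on the subsets of \<open>R\<close>
  that reverses the parity of the cardinality and preserves \<open>f\<close>.\<close>

lemma sum_even_eq_sum_odd_subsets:
  fixes f :: "'a set \<Rightarrow> 'b::comm_monoid_add"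
  assumes "finite R" "r \<in> R"
    and toggle: "\<And>S. S \<subseteq> R \<Longrightarrow> r \<notin> S \<Longrightarrow> f (insert r S) = f S"
  shows "(\<Sum>S | S \<subseteq> R \<and> even (card S). f S) = (\<Sum>S | S \<subseteq> R \<and> odd (card S). f S)"
proof -
  define t where "t = (\<lambda>S. if r \<in> S then S - {r} else insert r S)"
  have t: "t S \<subseteq> R" "even (card (t S)) \<longleftrightarrow> odd (card S)" "t (t S) = S" "f (t S) = f S"
    if "S \<subseteq> R" for S
  proof -
    have fin: "finite S" using that assms(1) finite_subset by blast
    show "t S \<subseteq> R" using that assms(2) by (auto simp: t_def)
    show "t (t S) = S" by (auto simp: t_def)
    show "even (card (t S)) \<longleftrightarrow> odd (card S)"
    proof (cases "r \<in> S")
      case True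
      hence "card S = Suc (card (S - {r}))" using fin by (metis card.remove)
      thus ?thesis using True by (simp add: t_def)
    qed (use fin in \<open>simp add: t_def\<close>)
    show "f (t S) = f S"
    proof (cases "r \<in> S")
      case True
      thus ?thesis using toggle[of "S - {r}"] that by (simp add: t_def insert_absorb subset_iff)
    qed (use toggle that in \<open>simp add: t_def\<close>)
  qed
  show ?thesis
    by (rule sum.reindex_bij_witness[where i = t and j = t]) (use t in auto)
qed

lemma prod_primes_dvd_iff:
  fixes n :: nat
  assumes "finite S" "\<And>s. s \<in> S \<Longrightarrow> prime s"
  shows "\<Prod>S dvd n \<longleftrightarrow> (\<forall>s\<in>S. s dvd n)"
proof
  assume "\<Prod>S dvd n"
  thus "\<forall>s\<in>S. s dvd n" using assms(1) by (meson dvd_prodI dvd_trans)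
next
  assume "\<forall>s\<in>S. s dvd n"
  with assms show "\<Prod>S dvd n"
  proof (induction S rule: finite_induct)
    case (insert s S)
    have "coprime s (\<Prod>S)"
      using insert by (intro prod_coprime_right) (metis insertI1 insertI2 primes_coprime)
    thus ?case using insert by (simp add: divides_mult)
  qed simp
qed

text \<open>A case of Zsigmondy's theorem. Taking \<open>a\<close> to be a multiple of
  \<open>k\<close> keeps every prime divisor of \<open>a ^ k - 1\<close> away from \<open>k\<close>,
  which excludes the exceptional pairs of the general theorem.\<close>

lemma exists_prime_ord_eq:
  fixes a k :: nat
  assumes "k > 1" "k dvd a" "a > 0"
  shows "\<exists>p. prime p \<and> ord p a = k"
proof (rule ccontr)
  assume "\<not> ?thesis"
  hence no: "ord p a \<noteq> k" if "prime p" for p using that by blast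
  have "a \<ge> 2" using dvd_imp_le[OF assms(2,3)] assms(1) by simp
  define R where "R = prime_factors k"
  have R_iff: "r \<in> R \<longleftrightarrow> prime r \<and> r dvd k" for r
    using assms(1) by (auto simp: R_def in_prime_factors_iff)
  have finR: "finite R" and Rp: "\<And>r. r \<in> R \<Longrightarrow> prime r"
    by (auto simp: R_def)
  have "R \<noteq> {}" using assms(1) by (auto simp: R_def prime_factorization_empty_iff)
  \<comment> \<open>The products \<open>\<Prod>S\<close> run over the squarefree divisors of
    \<open>k\<close>; their Moebius value is 1 for \<open>S\<close> in \<open>E\<close> and -1 for
    \<open>S\<close> in \<open>O'\<close>.\<close>
  define n where "n = (\<lambda>S. k div \<Prod>S)"
  define F where "F = (\<lambda>S. a ^ n S - 1)"
  define E where "E = {S. S \<subseteq> R \<and> even (card S)}"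
  define O' where "O' = {S. S \<subseteq> R \<and> odd (card S)}"
  have finEO: "finite E" "finite O'" using finR by (auto simp: E_def O'_def)
  have fin: "finite S" if "S \<subseteq> R" for S using that finR finite_subset by blast
  have dvdk: "\<Prod>S dvd k" if "S \<subseteq> R" for S
    using that fin[OF that] Rp by (subst prod_primes_dvd_iff) (auto simp: R_def subset_iff)
  have n: "n S dvd k" "n S > 0" "k = n S * \<Prod>S" if "S \<subseteq> R" for S
    using dvdk[OF that] assms(1) by (auto simp: n_def dvd_div_eq_0_iff intro!: Nat.gr0I)
  have F0: "F S \<noteq> 0" if "S \<subseteq> R" for S
  proof -
    have "a ^ n S > 1" using n(2)[OF that] \<open>a \<ge> 2\<close> by (intro one_less_power) auto
    thus ?thesis by (simp add: F_def)
  qed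
  \<comment> \<open>The quotient of the two products is the value at \<open>a\<close> of the \<open>k\<close>-th cyclotomic polynomial.
    If no prime has \<open>k\<close> as the order of \<open>a\<close>, the quotient is 1; reducing modulo the power of \<open>a\<close>
    just above the smallest exponent \<open>n R\<close> refutes this.\<close>
  have mult: "multiplicity p (\<Prod>S\<in>E. F S) = multiplicity p (\<Prod>S\<in>O'. F S)" if p: "prime p" for p
  proof -
    define d where "d = ord p a"
    have m: "multiplicity p (\<Prod>S\<in>X. F S) =
        (\<Sum>S\<in>X. if d dvd n S then multiplicity p (a ^ k - 1) else 0)"
      if X: "finite X" "\<And>S. S \<in> X \<Longrightarrow> S \<subseteq> R" for X
    proof -
      have "multiplicity p (\<Prod>S\<in>X. F S) = (\<Sum>S\<in>X. multiplicity p (F S))"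
        using p X F0 by (intro prime_elem_multiplicity_prod_distrib) (simp, metis imageE, simp)
      also have "\<dots> = (\<Sum>S\<in>X. if d dvd n S then multiplicity p (a ^ k - 1) else 0)"
        unfolding F_def d_def
        by (rule sum.cong[OF refl], rule multiplicity_power_minus_one)
          (use p X n(1) assms \<open>a \<ge> 2\<close> in auto)
      finally show ?thesis .
    qed
    have "(\<Sum>S\<in>E. if d dvd n S then multiplicity p (a ^ k - 1) else 0) =
          (\<Sum>S\<in>O'. if d dvd n S then multiplicity p (a ^ k - 1) else 0)"
    proof (cases "d dvd k")
      case False
      hence "\<not> d dvd n S" if "S \<subseteq> R" for S using n(1)[OF that] dvd_trans by blast
      thus ?thesis by (simp add: E_def O'_def)
    next
      case True
      then obtain l where l: "k = d * l" by blast
      have "d > 0" using l assms(1) by (cases d) auto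
      \<comment> \<open>Here the assumed absence of a prime with order \<open>k\<close> enters. It
        gives \<open>l\<close> a prime factor \<open>r\<close>, and since \<open>d dvd n S\<close>
        only asks every element of \<open>S\<close> to divide \<open>l\<close>, toggling
        \<open>r\<close> in \<open>S\<close> does not affect it.\<close>
      have "l \<noteq> 1" using l no[OF p] by (auto simp: d_def)
      then obtain r where r: "prime r" "r dvd l" using prime_factor_nat by blast
      have "r \<in> R" using r l by (simp add: R_iff)
      have iff: "d dvd n S \<longleftrightarrow> (\<forall>s\<in>S. s dvd l)" if "S \<subseteq> R" for S
      proof -
        have "\<Prod>S > 0" using n(3)[OF that] assms(1) by (auto intro!: Nat.gr0I)
        hence "d dvd n S \<longleftrightarrow> d * \<Prod>S dvd n S * \<Prod>S" by simp
        also have "\<dots> \<longleftrightarrow> d * \<Prod>S dvd d * l" using n(3)[OF that] l by simp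
        also have "\<dots> \<longleftrightarrow> \<Prod>S dvd l" using \<open>d > 0\<close> by simp
        finally show ?thesis using prod_primes_dvd_iff fin[OF that] Rp that by blast
      qed
      show ?thesis unfolding E_def O'_def
      proof (rule sum_even_eq_sum_odd_subsets[OF finR \<open>r \<in> R\<close>])
        fix S assume S: "S \<subseteq> R"
        have "d dvd n (insert r S) \<longleftrightarrow> d dvd n S"
          using iff[of "insert r S"] iff[OF S] S \<open>r \<in> R\<close> r(2) by simp
        thus "(if d dvd n (insert r S) then multiplicity p (a ^ k - 1) else 0) =
              (if d dvd n S then multiplicity p (a ^ k - 1) else 0)" by simp
      qed
    qed
    moreover have "S \<subseteq> R" if "S \<in> E \<union> O'" for S using that by (auto simp: E_def O'_def)
    ultimately show ?thesis using m[of E] m[of O'] finEO by simp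
  qed
  have eq: "(\<Prod>S\<in>E. F S) = (\<Prod>S\<in>O'. F S)"
    by (rule multiplicity_eq_nat) (use F0 finEO mult in \<open>auto simp: E_def O'_def intro!: prod_pos Nat.gr0I\<close>)
  have cardEO: "card E = card O'"
    using sum_even_eq_sum_odd_subsets[OF finR, of _ "\<lambda>_. 1::nat"] \<open>R \<noteq> {}\<close>
    by (auto simp: E_def O'_def)
  define s where "s = n R"
  define M where "M = int a ^ (s + 1)"
  have Fint: "int (F S) = int a ^ n S - 1" for S
    using \<open>a \<ge> 2\<close> by (simp add: F_def of_nat_diff)
  \<comment> \<open>Every other exponent \<open>n S\<close> is a proper multiple of
    \<open>n R\<close>, so all factors except \<open>F R\<close> reduce to -1 modulo
    \<open>M\<close>.\<close>
  have F_cong: "[int (F S) = -1] (mod M)" if "S \<subseteq> R" "S \<noteq> R" for S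
  proof -
    have "n S > s"
    proof -
      have sub: "\<Prod>R = \<Prod>S * \<Prod>(R - S)"
        using that finR by (metis prod.subset_diff mult.commute)
      from that obtain r where "r \<in> R" "r \<notin> S" by blast
      have "r dvd \<Prod>(R - S)" using \<open>r \<in> R\<close> \<open>r \<notin> S\<close> finR by (intro dvd_prodI) auto
      moreover have "\<Prod>(R - S) > 0" using Rp by (intro prod_pos) (auto simp: prime_gt_0_nat)
      ultimately have "\<Prod>(R - S) \<ge> r" using dvd_imp_le by blast
      hence "\<Prod>(R - S) > 1" using prime_gt_1_nat[OF Rp[OF \<open>r \<in> R\<close>]] by linarith
      have "n S * \<Prod>S = s * \<Prod>(R - S) * \<Prod>S"
        using n(3)[OF that(1)] n(3)[of R, unfolded sub]
        by (metis mult.commute mult.left_commute order_refl s_def)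
      moreover have "\<Prod>S > 0" using n(3)[OF that(1)] assms(1) by (auto intro!: Nat.gr0I)
      ultimately have "n S = s * \<Prod>(R - S)" by simp
      thus ?thesis using \<open>\<Prod>(R - S) > 1\<close> n(2)[of R] by (simp add: s_def)
    qed
    hence "M dvd int a ^ n S" unfolding M_def by (intro le_imp_power_dvd) simp
    thus ?thesis by (simp add: Fint cong_iff_dvd_diff)
  qed
  \<comment> \<open>\<open>X\<close> stands for whichever of \<open>E\<close> and \<open>O'\<close>
    contains \<open>R\<close>. Both families have equally many members, so the signs cancel to leave
    \<open>F R\<close> congruent to -1, that is, \<open>a ^ s\<close> congruent to 0.\<close>
  have X: "[int a ^ s = 0] (mod M)"
    if X: "finite X" "finite Y" "card X = card Y" "R \<in> X" "R \<notin> Y"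
      "\<And>S. S \<in> X \<union> Y \<Longrightarrow> S \<subseteq> R" "(\<Prod>S\<in>X. F S) = (\<Prod>S\<in>Y. F S)" for X Y
  proof -
    define N where "N = card (X - {R})"
    have cY: "card Y = Suc N" using X(3) card.remove[OF X(1,4)] by (simp add: N_def)
    have 1: "[(\<Prod>S\<in>Y. int (F S)) = (\<Prod>S\<in>Y. -1)] (mod M)"
      by (rule cong_prod) (use X F_cong in blast)
    have 2: "[(\<Prod>S\<in>X - {R}. int (F S)) = (\<Prod>S\<in>X - {R}. -1)] (mod M)"
      by (rule cong_prod) (use X F_cong in blast)
    have "(\<Prod>S\<in>X. int (F S)) = (\<Prod>S\<in>Y. int (F S))"
      using X(7) by (metis of_nat_prod)
    moreover have "(\<Prod>S\<in>X. int (F S)) = int (F R) * (\<Prod>S\<in>X - {R}. int (F S))"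
      using X by (simp add: prod.remove)
    ultimately have "[int (F R) * (-1) ^ N = (-1) ^ Suc N] (mod M)"
      using 1 2 cong_mult[OF cong_refl 2, of "int (F R)"] cY
      by (metis N_def cong_sym cong_trans prod_constant)
    hence "[int (F R) * (-1) ^ N * (-1) ^ N = (-1) ^ Suc N * (-1) ^ N] (mod M)"
      by (rule cong_mult) simp
    hence "[int (F R) = -1] (mod M)"
      by (simp add: mult.assoc flip: power_add mult_2)
    thus ?thesis by (simp add: Fint s_def cong_iff_dvd_diff)
  qed
  have "[int a ^ s = 0] (mod M)"
  proof (cases "even (card R)")
    case True
    show ?thesis by (rule X[of E O']) (use True finEO cardEO eq in \<open>auto simp: E_def O'_def\<close>)
  next
    case False
    show ?thesis by (rule X[of O' E]) (use False finEO cardEO eq in \<open>auto simp: E_def O'_def\<close>)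
  qed
  hence "M dvd int a ^ s" by (simp add: cong_0_iff)
  hence "M \<le> int a ^ s" using assms(3) by (intro zdvd_imp_le) auto
  thus False using \<open>a \<ge> 2\<close> by (simp add: M_def)
qed

text \<open>The residue 1 case of Dirichlet's theorem: the order of \<open>a\<close> modulo
  \<open>p\<close> divides \<open>p - 1\<close>.\<close>

lemma exists_large_prime_cong_1:
  fixes k N :: nat
  assumes "k > 0"
  shows "\<exists>p. prime p \<and> p > N \<and> k dvd p - 1"
proof -
  \<comment> \<open>The factor \<open>fact N\<close> makes every prime up to \<open>N\<close> divide
    \<open>a\<close>, so \<open>a\<close> has order 0 modulo each of them. The factor 2 keeps the
    order \<open>2 * k\<close> above 1 even when \<open>k = 1\<close>.\<close>
  define a where "a = 2 * k * fact N"
  have "\<exists>p. prime p \<and> ord p a = 2 * k"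
    by (rule exists_prime_ord_eq) (use assms in \<open>auto simp: a_def\<close>)
  then obtain p where p: "prime p" "ord p a = 2 * k" by blast
  have co: "coprime p a" using p(2) assms by (metis mult_is_0 neq0_conv ord_eq_0 zero_neq_numeral)
  have "p > N"
  proof (rule ccontr)
    assume "\<not> p > N"
    hence "p dvd fact N" using p(1) by (simp add: prime_dvd_fact_iff)
    hence "p dvd a" by (simp add: a_def)
    thus False using co p(1) by (metis coprime_absorb_left not_prime_unit)
  qed
  moreover have "2 * k dvd p - 1"
    using order_divides_totient[OF co] p by (simp add: totient_prime)
  ultimately show ?thesis using p(1) by (meson dvd_mult_right)
qed

section \<open>Cyclotomic classes\<close>

text \<open>Requiring \<open>2 * m\<close>, and not just \<open>m\<close>, to divide
  \<open>p - 1\<close> makes -1 an \<open>m\<close>-th power, so that the class of a difference does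
  not depend on the direction of the edge.\<close>

locale cyclotomic =
  fixes p g m :: nat
  assumes prime_p: "prime p"
    and primroot: "residue_primroot p g"
    and m_pos: "m > 0"
    and m_dvd: "2 * m dvd p - 1"
begin

definition Zp :: "int set" where "Zp = {0..<int p}"

definition dlog :: "int \<Rightarrow> nat" where
  "dlog z = (SOME i. i < p - 1 \<and> [z = int g ^ i] (mod int p))"

text \<open>The number of the coset of the nonzero \<open>m\<close>-th powers that contains
  \<open>z\<close>. On multiples of \<open>p\<close> the value is arbitrary, but still below
  \<open>m\<close>.\<close>

definition cl :: "int \<Rightarrow> nat" where "cl z = dlog z mod m"

text \<open>The number of nonzero \<open>m\<close>-th powers modulo \<open>p\<close>.\<close>

definition h :: nat where "h = (p - 1) div m"

lemma p_gt_2: "p > 2"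
proof -
  have "2 dvd p - 1" using m_dvd by (meson dvd_mult_left)
  thus ?thesis using prime_gt_1_nat[OF prime_p] by (cases "p = 2") auto
qed

lemma p_eq: "p = m * h + 1"
proof -
  have "m dvd p - 1" using m_dvd by (meson dvd_mult_right)
  thus ?thesis using p_gt_2 by (simp add: h_def)
qed

lemma p_minus_1: "p - 1 = m * h"
  using p_eq by simp

lemma even_h: "even h"
proof -
  have "2 * m dvd m * h" using m_dvd by (simp only: p_minus_1)
  thus ?thesis using m_pos by (metis dvd_mult_cancel2 mult.commute nat_mult_dvd_cancel_disj neq0_conv)
qed

lemma prime_int_p: "prime (int p)"
  using prime_p by simp

lemma not_dvd_g: "\<not> int p dvd int g ^ i"
proof -
  have "coprime p g" using primroot by (simp add: residue_primroot_def)
  hence "coprime (int p) (int g)" by simp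
  thus ?thesis using prime_int_p by (metis coprime_absorb_left coprime_power_right_iff not_prime_unit)
qed

lemma dlog_exists:
  assumes "\<not> int p dvd z"
  shows "\<exists>i<p - 1. [z = int g ^ i] (mod int p)"
proof -
  define w where "w = nat (z mod int p)"
  have w: "int w = z mod int p" using p_gt_2 by (simp add: w_def)
  have "\<not> p dvd w" using assms by (metis dvd_imp_mod_0 dvd_mod_iff dvd_refl int_dvd_int_iff w)
  hence "coprime w p" using prime_p by (meson coprime_commute prime_imp_coprime)
  moreover have "w > 0" using \<open>\<not> p dvd w\<close> by (metis dvd_0_right neq0_conv)
  moreover have "w \<le> p"
    using p_gt_2 by (simp add: w_def nat_le_iff less_imp_le)
  ultimately have "w \<in> totatives p" by (simp add: totatives_def)
  moreover have "bij_betw (\<lambda>i. g ^ i mod p) {..<totient p} (totatives p)"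
    using residue_primroot_is_generator[of p g] p_gt_2 primroot by simp
  ultimately have "w \<in> (\<lambda>i. g ^ i mod p) ` {..<totient p}" by (simp only: bij_betw_imp_surj_on)
  then obtain i where i: "i < totient p" "w = g ^ i mod p" by blast
  have "z mod int p = int g ^ i mod int p" using i(2) w by (simp add: of_nat_mod)
  thus ?thesis using i(1) prime_p by (auto simp: totient_prime cong_def)
qed

lemma power_cong_iff: "[int g ^ i = int g ^ j] (mod int p) \<longleftrightarrow> [i = j] (mod p - 1)"
proof -
  have "coprime p g" "ord p g = p - 1"
    using primroot prime_p by (simp_all add: residue_primroot_def totient_prime)
  hence "[g ^ i = g ^ j] (mod p) \<longleftrightarrow> [i = j] (mod p - 1)"
    using order_divides_expdiff[of p g i j] by simp
  thus ?thesis by (simp only: cong_int_iff flip: of_nat_power)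
qed

lemma dlog_props:
  assumes "\<not> int p dvd z"
  shows "dlog z < p - 1" "[z = int g ^ dlog z] (mod int p)"
proof -
  have "dlog z < p - 1 \<and> [z = int g ^ dlog z] (mod int p)"
    unfolding dlog_def by (rule someI_ex) (rule dlog_exists[OF assms])
  thus "dlog z < p - 1" "[z = int g ^ dlog z] (mod int p)" by auto
qed

lemma m_dvd': "m dvd p - 1"
  using m_dvd by (rule dvd_mult_right)

lemma cl_eqI:
  assumes "[z = int g ^ i] (mod int p)"
  shows "cl z = i mod m"
proof -
  have nd: "\<not> int p dvd z" using not_dvd_g[of i] by (simp add: cong_dvd_iff[OF assms])
  have "[int g ^ dlog z = int g ^ i] (mod int p)"
    by (rule cong_trans[OF cong_sym[OF dlog_props(2)[OF nd]] assms])
  hence "[dlog z = i] (mod p - 1)" by (simp only: power_cong_iff)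
  hence "[dlog z = i] (mod m)" using m_dvd' cong_dvd_modulus_nat by blast
  thus ?thesis by (simp add: cl_def cong_def)
qed

lemma cl_less: "cl z < m"
  using m_pos by (simp add: cl_def)

text \<open>The exponent is half the order of \<open>g\<close>, so the power is a square root of 1
  other than 1. As \<open>h\<close> is even, the exponent is also a multiple of
  \<open>m\<close>.\<close>

lemma power_half: "[int g ^ (m * (h div 2)) = -1] (mod int p)"
proof -
  define y where "y = int g ^ (m * (h div 2))"
  have hh: "m * (h div 2) + m * (h div 2) = p - 1"
    using even_h p_minus_1 by (metis distrib_left dvd_div_mult_self mult_2_right)
  have "[int g ^ (p - 1) = int g ^ 0] (mod int p)"
    unfolding power_cong_iff by (simp add: cong_0_iff)
  hence "[y * y = 1] (mod int p)"
    by (simp only: y_def hh power_0 flip: power_add)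
  hence "int p dvd (y - 1) * (y + 1)"
    by (simp add: cong_iff_dvd_diff algebra_simps)
  moreover have "\<not> int p dvd y - 1"
  proof
    assume "int p dvd y - 1"
    hence "[int g ^ (m * (h div 2)) = int g ^ 0] (mod int p)" by (simp add: cong_iff_dvd_diff y_def)
    hence "p - 1 dvd m * (h div 2)" unfolding power_cong_iff by (simp add: cong_0_iff)
    moreover have "0 < m * (h div 2)" using hh p_gt_2 by linarith
    ultimately have "p - 1 \<le> m * (h div 2)" using dvd_imp_le by blast
    thus False using hh \<open>0 < m * (h div 2)\<close> by linarith
  qed
  ultimately have "int p dvd y + 1" using prime_int_p prime_dvd_mult_iff by blast
  thus ?thesis by (simp add: y_def cong_iff_dvd_diff)
qed

lemma cl_uminus:
  assumes "\<not> int p dvd z"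
  shows "cl (- z) = cl z"
proof -
  have "[- 1 * z = int g ^ (m * (h div 2)) * int g ^ dlog z] (mod int p)"
    by (intro cong_mult) (use power_half dlog_props[OF assms] in \<open>auto simp: cong_sym\<close>)
  hence "cl (- z) = (m * (h div 2) + dlog z) mod m"
    by (intro cl_eqI) (simp add: power_add)
  thus ?thesis by (simp add: cl_def)
qed

text \<open>The indices of \<open>z\<close> and \<open>w\<close> differ by a multiple of
  \<open>m\<close>, so their quotient is one of the \<open>h\<close> nonzero \<open>m\<close>-th
  powers.\<close>

lemma cl_eqD:
  assumes "\<not> int p dvd z" "\<not> int p dvd w" "cl z = cl w"
  shows "\<exists>j<h. [z = int g ^ (m * j) * w] (mod int p)"
proof -
  have i: "dlog z < p - 1" "dlog w < p - 1" using dlog_props assms by auto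
  \<comment> \<open>The difference of the indices modulo \<open>p - 1\<close>, written so that the
    subtraction of naturals does not truncate.\<close>
  define t where "t = (dlog z + (p - 1 - dlog w)) mod (p - 1)"
  have t: "[t + dlog w = dlog z] (mod p - 1)"
  proof -
    have "[t + dlog w = dlog z + (p - 1 - dlog w) + dlog w] (mod p - 1)"
      unfolding t_def by (simp add: cong_def mod_simps)
    also have "dlog z + (p - 1 - dlog w) + dlog w = dlog z + (p - 1)" using i by simp
    finally show ?thesis by (simp add: cong_def)
  qed
  hence "[t + dlog w = 0 + dlog w] (mod m)"
    using cong_dvd_modulus_nat[OF t m_dvd'] assms(3) by (simp add: cl_def cong_def)
  hence "[t = 0] (mod m)" by (simp only: cong_add_rcancel_nat)
  then obtain j where j: "t = m * j" by (auto simp: cong_0_iff)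
  have "t < p - 1" unfolding t_def using p_gt_2 by simp
  hence "m * j < m * h" using j p_eq by linarith
  hence "j < h" using m_pos by simp
  have "[int g ^ (t + dlog w) = int g ^ dlog z] (mod int p)" using t power_cong_iff by blast
  moreover have "[int g ^ t * w = int g ^ t * int g ^ dlog w] (mod int p)"
    by (intro cong_mult cong_refl dlog_props assms)
  ultimately have "[z = int g ^ t * w] (mod int p)"
    using dlog_props(2)[OF assms(1)] by (metis cong_sym cong_trans power_add)
  thus ?thesis using \<open>j < h\<close> j by blast
qed

lemma Zp_dvd_diff_iff:
  assumes "x \<in> Zp" "y \<in> Zp"
  shows "int p dvd x - y \<longleftrightarrow> x = y"
proof -
  have "int p dvd x - y \<longleftrightarrow> x mod int p = y mod int p" by (simp add: mod_eq_dvd_iff)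
  thus ?thesis using assms by (simp add: Zp_def)
qed

lemma finite_Zp: "finite Zp" and card_Zp: "card Zp = p"
  by (simp_all add: Zp_def)

lemma card_Zp_remove: "a \<in> Zp \<Longrightarrow> card (Zp - {a}) = m * h"
  by (simp add: card_Diff_singleton card_Zp flip: p_minus_1)

lemma card_same_class:
  assumes ab: "a \<in> Zp" "b \<in> Zp" "a \<noteq> b"
  shows "card {x \<in> Zp. x \<noteq> a \<and> x \<noteq> b \<and> cl (x - a) = cl (x - b)} \<le> h - 1" (is "card ?S \<le> _")
proof -
  \<comment> \<open>The ratio \<open>(x - a) / (x - b)\<close> is an \<open>m\<close>-th power different from 1, and it determines \<open>x\<close>.\<close>
  have "\<exists>j<h. [x - a = int g ^ (m * j) * (x - b)] (mod int p)" if "x \<in> ?S" for x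
  proof (rule cl_eqD)
    show "\<not> int p dvd x - a" "\<not> int p dvd x - b" "cl (x - a) = cl (x - b)"
      using that ab by (simp_all add: Zp_dvd_diff_iff)
  qed
  hence "\<forall>x\<in>?S. \<exists>j. j < h \<and> [x - a = int g ^ (m * j) * (x - b)] (mod int p)" by blast
  from bchoice[OF this] obtain J
    where J': "\<forall>x\<in>?S. J x < h \<and> [x - a = int g ^ (m * J x) * (x - b)] (mod int p)" ..
  hence J: "J x < h" "[x - a = int g ^ (m * J x) * (x - b)] (mod int p)" if "x \<in> ?S" for x
    using that by blast+
  have J0: "J x \<noteq> 0" if "x \<in> ?S" for x
  proof
    assume "J x = 0"
    hence "[x - a = x - b] (mod int p)" using J(2)[OF that] by simp
    hence "int p dvd b - a" by (simp add: cong_iff_dvd_diff)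
    thus False using Zp_dvd_diff_iff ab by blast
  qed
  have "inj_on J ?S"
  proof (rule inj_onI)
    fix x y assume x: "x \<in> ?S" and y: "y \<in> ?S" and eq: "J x = J y"
    define u where "u = int g ^ (m * J x)"
    have "[(x - a) - (y - a) = u * (x - b) - u * (y - b)] (mod int p)"
      using J(2)[OF x] J(2)[OF y] eq unfolding u_def by (intro cong_diff) auto
    hence "int p dvd ((x - a) - (y - a)) - (u * (x - b) - u * (y - b))"
      by (simp only: cong_iff_dvd_diff)
    also have "((x - a) - (y - a)) - (u * (x - b) - u * (y - b)) = (1 - u) * (x - y)"
      by (simp add: algebra_simps)
    finally have "int p dvd 1 - u \<or> int p dvd x - y"
      using prime_int_p prime_dvd_mult_iff by blast
    moreover have "\<not> int p dvd 1 - u"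
    proof
      assume "int p dvd 1 - u"
      hence "[int g ^ 0 = int g ^ (m * J x)] (mod int p)" by (simp add: cong_iff_dvd_diff u_def)
      hence "[0 = m * J x] (mod p - 1)" by (simp only: power_cong_iff)
      hence "p - 1 dvd m * J x" by (metis cong_sym cong_0_iff)
      hence "m * h dvd m * J x" by (simp only: p_minus_1)
      hence "h dvd J x" using m_pos by simp
      thus False using J0[OF x] J(1)[OF x] by (simp add: nat_dvd_not_less)
    qed
    ultimately show "x = y" using Zp_dvd_diff_iff x y by blast
  qed
  hence "card ?S = card (J ` ?S)" by (simp add: card_image)
  also have "\<dots> \<le> card {1..<h}"
    by (rule card_mono) (use J(1) J0 in \<open>auto simp: Suc_le_eq\<close>)
  finally show ?thesis by simp
qed

section \<open>First and second moments of the class counts seen from a point\<close>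

text \<open>The condition \<open>a \<noteq> x\<close> leaves out the difference 0, whose class is
  arbitrary.\<close>

definition hits :: "int set \<Rightarrow> nat \<Rightarrow> int \<Rightarrow> int set" where
  "hits A c x = {a \<in> A. a \<noteq> x \<and> cl (x - a) = c}"

lemma card_filter: "finite A \<Longrightarrow> card {x \<in> A. P x} = (\<Sum>x\<in>A. of_bool (P x))"
  by (simp add: sum.If_cases of_bool_def Int_def)

text \<open>First moment: after exchanging the sums, each \<open>a\<close> is counted in exactly one
  class for each of the \<open>m * h\<close> points \<open>x\<close> other than
  \<open>a\<close>.\<close>

lemma sum_card_hits:
  assumes A: "A \<subseteq> Zp"
  shows "(\<Sum>x\<in>Zp. \<Sum>c<m. card (hits A c x)) = card A * (m * h)"
proof -
  have fA: "finite A" using A finite_Zp finite_subset by blast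
  have "(\<Sum>c<m. card (hits A c x)) = card (A - {x})" for x
  proof -
    have "A - {x} = (\<Union>c\<in>{..<m}. hits A c x)" using cl_less by (auto simp: hits_def)
    also have "card \<dots> = (\<Sum>c<m. card (hits A c x))"
      by (rule card_UN_disjoint) (use fA in \<open>auto simp: hits_def\<close>)
    finally show ?thesis by simp
  qed
  hence "(\<Sum>x\<in>Zp. \<Sum>c<m. card (hits A c x)) = (\<Sum>x\<in>Zp. card (A - {x}))" by simp
  also have "\<dots> = (\<Sum>x\<in>Zp. \<Sum>a\<in>A. of_bool (a \<noteq> x))"
    by (intro sum.cong refl) (simp only: card_filter[OF fA, symmetric] set_diff_eq singleton_iff)
  also have "\<dots> = (\<Sum>a\<in>A. \<Sum>x\<in>Zp. of_bool (a \<noteq> x))" by (rule sum.swap)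
  also have "\<dots> = (\<Sum>a\<in>A. card (Zp - {a}))"
    by (intro sum.cong refl)
      (simp only: card_filter[OF finite_Zp, symmetric] set_diff_eq singleton_iff eq_commute)
  also have "\<dots> = (\<Sum>a\<in>A. m * h)"
    using A by (intro sum.cong refl card_Zp_remove) blast
  finally show ?thesis by simp
qed

text \<open>Second moment: the squares count ordered pairs from \<open>A\<close> whose differences
  from \<open>x\<close> share a class. A diagonal pair is counted for at most \<open>m * h\<close>
  points \<open>x\<close>, any other pair for at most \<open>h - 1\<close> by
  \<open>card_same_class\<close>.\<close>

lemma sum_card_hits_squared:
  assumes A: "A \<subseteq> Zp"
  shows "(\<Sum>x\<in>Zp. \<Sum>c<m. card (hits A c x) ^ 2) \<le> card A * (m * h) + card A * (card A - 1) * (h - 1)"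
proof -
  have fA: "finite A" using A finite_Zp finite_subset by blast
  define S where "S = (\<lambda>a b. {x \<in> Zp. x \<noteq> a \<and> x \<noteq> b \<and> cl (x - a) = cl (x - b)})"
  have "(\<Sum>c<m. card (hits A c x) ^ 2) = card {(a, b) \<in> A \<times> A. x \<in> S a b}" if x: "x \<in> Zp" for x
  proof -
    have "{(a, b) \<in> A \<times> A. x \<in> S a b} = (\<Union>c\<in>{..<m}. hits A c x \<times> hits A c x)"
      using cl_less x by (auto simp: hits_def S_def)
    also have "card \<dots> = (\<Sum>c<m. card (hits A c x \<times> hits A c x))"
      by (rule card_UN_disjoint) (use fA in \<open>auto simp: hits_def\<close>)
    finally show ?thesis by (simp add: card_cartesian_product power2_eq_square)
  qed
  hence "(\<Sum>x\<in>Zp. \<Sum>c<m. card (hits A c x) ^ 2) = (\<Sum>x\<in>Zp. card {(a, b) \<in> A \<times> A. x \<in> S a b})" by simp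
  also have "\<dots> = (\<Sum>x\<in>Zp. \<Sum>ab\<in>A \<times> A. of_bool (x \<in> S (fst ab) (snd ab)))"
  proof (intro sum.cong refl)
    fix x
    have "{(a, b) \<in> A \<times> A. x \<in> S a b} = {ab \<in> A \<times> A. x \<in> S (fst ab) (snd ab)}" by auto
    also have "card \<dots> = (\<Sum>ab\<in>A \<times> A. of_bool (x \<in> S (fst ab) (snd ab)))"
      by (rule card_filter) (use fA in simp)
    finally show "card {(a, b) \<in> A \<times> A. x \<in> S a b} = \<dots>" .
  qed
  also have "\<dots> = (\<Sum>ab\<in>A \<times> A. \<Sum>x\<in>Zp. of_bool (x \<in> S (fst ab) (snd ab)))"
    by (rule sum.swap)
  also have "\<dots> = (\<Sum>ab\<in>A \<times> A. card (S (fst ab) (snd ab)))"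
  proof (intro sum.cong refl)
    fix ab
    have "(\<Sum>x\<in>Zp. of_bool (x \<in> S (fst ab) (snd ab))) = card {x \<in> Zp. x \<in> S (fst ab) (snd ab)}"
      by (rule card_filter[symmetric]) (rule finite_Zp)
    also have "{x \<in> Zp. x \<in> S (fst ab) (snd ab)} = S (fst ab) (snd ab)" by (auto simp: S_def)
    finally show "(\<Sum>x\<in>Zp. of_bool (x \<in> S (fst ab) (snd ab))) = card (S (fst ab) (snd ab))" .
  qed
  also have "\<dots> = (\<Sum>a\<in>A. \<Sum>b\<in>A. card (S a b))"
    by (simp add: sum.cartesian_product case_prod_unfold)
  also have "\<dots> \<le> (\<Sum>a\<in>A. m * h + (card A - 1) * (h - 1))"
  proof (rule sum_mono)
    fix a assume a: "a \<in> A"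
    have "card (S a a) \<le> card (Zp - {a})" by (rule card_mono) (auto simp: S_def finite_Zp)
    also have "\<dots> = m * h" using a A by (intro card_Zp_remove) blast
    finally have 1: "card (S a a) \<le> m * h" .
    have "(\<Sum>b\<in>A - {a}. card (S a b)) \<le> (\<Sum>b\<in>A - {a}. h - 1)"
      by (rule sum_mono) (unfold S_def, rule card_same_class, use a A in auto)
    hence "(\<Sum>b\<in>A - {a}. card (S a b)) \<le> (card A - 1) * (h - 1)"
      using a fA by (simp add: card_Diff_singleton)
    with 1 show "(\<Sum>b\<in>A. card (S a b)) \<le> m * h + (card A - 1) * (h - 1)"
      using a fA by (simp add: sum.remove)
  qed
  also have "\<dots> = card A * (m * h) + card A * (card A - 1) * (h - 1)"
    by (simp add: distrib_left mult.assoc)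
  finally show ?thesis .
qed

text \<open>Scaling by \<open>m\<close> keeps the deviation from the expected count, about
  \<open>card A / m\<close>, integral. After expansion the terms \<open>k ^ 2 * H * s ^ 2\<close>
  cancel, which leaves a bound linear in \<open>card A\<close>.\<close>

lemma variance_hits:
  assumes A: "A \<subseteq> Zp"
  shows "(\<Sum>x\<in>Zp. \<Sum>c<m. (int m * int (card (hits A c x)) - int (card A)) ^ 2) \<le> int m ^ 2 * int p * int (card A)"
proof -
  define s where "s = int (card A)"
  define H where "H = int h"
  define k where "k = int m"
  have k: "k \<ge> 1" using m_pos by (simp add: k_def)
  have "h > 0" using p_eq p_gt_2 by (intro Nat.gr0I) auto
  hence H: "H \<ge> 1" by (simp add: H_def)
  have s: "s \<ge> 0" by (simp add: s_def)
  have 1: "(\<Sum>x\<in>Zp. \<Sum>c<m. int (card (hits A c x))) = s * (k * H)"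
    using arg_cong[OF sum_card_hits[OF A], of int] by (simp add: s_def k_def H_def)
  have "int (\<Sum>x\<in>Zp. \<Sum>c<m. card (hits A c x) ^ 2)
      \<le> int (card A * (m * h) + card A * (card A - 1) * (h - 1))"
    using sum_card_hits_squared[OF A] by (simp only: of_nat_le_iff)
  also have "\<dots> = s * (k * H) + s * (s - 1) * (H - 1)"
    using \<open>h > 0\<close> by (cases "card A = 0") (auto simp: s_def k_def H_def of_nat_diff)
  finally have 2: "(\<Sum>x\<in>Zp. \<Sum>c<m. int (card (hits A c x)) ^ 2) \<le> s * (k * H) + s * (s - 1) * (H - 1)"
    by simp
  have "(\<Sum>x\<in>Zp. \<Sum>c<m. (k * int (card (hits A c x)) - s) ^ 2)
      = (\<Sum>x\<in>Zp. \<Sum>c<m. k ^ 2 * int (card (hits A c x)) ^ 2 - 2 * k * s * int (card (hits A c x)) + s ^ 2)"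
    by (intro sum.cong refl) (simp add: power2_eq_square algebra_simps)
  also have "\<dots> = k ^ 2 * (\<Sum>x\<in>Zp. \<Sum>c<m. int (card (hits A c x)) ^ 2)
      - 2 * k * s * (\<Sum>x\<in>Zp. \<Sum>c<m. int (card (hits A c x))) + int p * (k * s ^ 2)"
    by (simp add: sum.distrib sum_subtractf sum_distrib_left card_Zp k_def)
  also have "\<dots> \<le> k ^ 2 * (s * (k * H) + s * (s - 1) * (H - 1)) - 2 * k * s * (s * (k * H)) + int p * (k * s ^ 2)"
    unfolding 1 using 2 by (intro add_right_mono diff_right_mono mult_left_mono) auto
  also have "int p = k * H + 1" using arg_cong[OF p_eq, of int] by (simp add: k_def H_def)
  also have "k ^ 2 * (s * (k * H) + s * (s - 1) * (H - 1)) - 2 * k * s * (s * (k * H)) + (k * H + 1) * (k * s ^ 2)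
      = k ^ 2 * (k * H + 1) * s - (k * (k - 1) * s ^ 2 + k ^ 2 * H * s)"
    by (simp add: power2_eq_square algebra_simps)
  also have "\<dots> \<le> k ^ 2 * (k * H + 1) * s"
  proof -
    have "0 \<le> k * (k - 1) * s ^ 2" "0 \<le> k ^ 2 * H * s" using k H s by simp_all
    thus ?thesis by linarith
  qed
  also have "k * H + 1 = int p" using arg_cong[OF p_eq, of int] by (simp add: k_def H_def)
  finally show ?thesis by (simp add: k_def s_def)
qed

text \<open>Chebyshev's inequality: at a point with fewer than half the expected hits, the scaled
  deviation in class \<open>c\<close> exceeds half of \<open>card A\<close>, so its square
  contributes at least a quarter of \<open>card A ^ 2\<close> to the variance.\<close>

lemma card_bad:
  assumes A: "A \<subseteq> Zp" and c: "c < m"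
  shows "card {x \<in> Zp. 2 * m * card (hits A c x) < card A} * card A \<le> (2 * m) ^ 2 * p" (is "card ?B * _ \<le> _")
proof (cases "card A = 0")
  case False
  define s where "s = int (card A)"
  have "int (card ?B) * s ^ 2 = (\<Sum>x\<in>?B. s ^ 2)" by simp
  also have "\<dots> \<le> (\<Sum>x\<in>?B. 4 * (int m * int (card (hits A c x)) - s) ^ 2)"
  proof (rule sum_mono)
    fix x assume "x \<in> ?B"
    hence "int (2 * m * card (hits A c x)) < s" by (simp add: s_def del: of_nat_mult)
    hence "s \<le> 2 * (s - int m * int (card (hits A c x)))" by simp
    hence "s ^ 2 \<le> (2 * (s - int m * int (card (hits A c x)))) ^ 2"
      by (rule power_mono) (simp add: s_def)
    thus "s ^ 2 \<le> 4 * (int m * int (card (hits A c x)) - s) ^ 2"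
      by (simp add: power2_eq_square algebra_simps)
  qed
  also have "\<dots> \<le> (\<Sum>x\<in>Zp. 4 * (int m * int (card (hits A c x)) - s) ^ 2)"
    by (rule sum_mono2) (auto simp: finite_Zp)
  also have "\<dots> \<le> (\<Sum>x\<in>Zp. 4 * (\<Sum>c<m. (int m * int (card (hits A c x)) - s) ^ 2))"
    by (intro sum_mono mult_left_mono member_le_sum) (use c in auto)
  also have "\<dots> \<le> 4 * (int m ^ 2 * int p * s)"
    using variance_hits[OF A] by (simp add: s_def flip: sum_distrib_left)
  finally have "(int (card ?B) * s) * s \<le> (4 * int m ^ 2 * int p) * s"
    by (simp add: power2_eq_square algebra_simps)
  moreover have "s > 0" using False by (simp add: s_def)
  ultimately have "int (card ?B) * s \<le> 4 * int m ^ 2 * int p" by (simp only: mult_le_cancel_right_pos)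
  hence "int (card ?B * card A) \<le> int ((2 * m) ^ 2 * p)" by (simp add: s_def power2_eq_square)
  thus ?thesis by (simp only: of_nat_le_iff)
qed simp

text \<open>
  \<open>A j\<close> is the set of candidates still available for \<open>j\<close>, of density at least \<open>1 / D\<close>. Each placed
  vertex shrinks the other candidate sets by a factor of at most \<open>2 * m\<close>, as long as it avoids the
  bounded number of points excluded by \<open>card_bad\<close>.
\<close>

lemma greedy_embedding:
  fixes c :: "'v \<Rightarrow> 'v \<Rightarrow> nat"
  assumes "finite J" "D \<ge> 1"
    and "\<And>j. j \<in> J \<Longrightarrow> A j \<subseteq> Zp" "\<And>j. j \<in> J \<Longrightarrow> p \<le> card (A j) * D"
    and "p > card J * (2 * m) ^ 2 * (D * (2 * m) ^ card J) ^ 2"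
    and c: "\<And>i j. c i j < m" "\<And>i j. c i j = c j i"
  shows "\<exists>\<phi>. \<forall>i\<in>J. \<phi> i \<in> A i \<and> (\<forall>j\<in>J. i \<noteq> j \<longrightarrow> \<phi> i \<noteq> \<phi> j \<and> cl (\<phi> i - \<phi> j) = c i j)"
  using assms(1-5)
proof (induction J arbitrary: A D rule: finite_induct)
  case (insert k J)
  define L where "L = 2 * m"
  have L1: "L \<ge> 1" using m_pos by (simp add: L_def)
  define n where "n = card J"
  have big: "p > Suc n * L ^ 2 * (D * L ^ Suc n) ^ 2"
    using insert.prems(4) insert.hyps by (simp add: L_def n_def)
  define bad where "bad = (\<lambda>j. {x \<in> Zp. 2 * m * card (hits (A j) (c k j) x) < card (A j)})"
  have fbad: "finite (bad j)" for j by (simp add: bad_def finite_Zp)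
  have card_bad: "card (bad j) \<le> L ^ 2 * D" if "j \<in> J" for j
  proof -
    \<comment> \<open>As \<open>A j\<close> has at least \<open>p / D\<close> elements, the
      Chebyshev bound becomes independent of \<open>p\<close>.\<close>
    have "card (bad j) * p \<le> card (bad j) * (card (A j) * D)"
      using insert.prems(3)[of j] that by (intro mult_left_mono) auto
    also have "\<dots> = card (bad j) * card (A j) * D" by simp
    also have "\<dots> \<le> L ^ 2 * p * D"
      unfolding bad_def L_def using insert.prems(2)[of j] that c(1)
      by (intro mult_right_mono card_bad) auto
    finally have "card (bad j) * p \<le> (L ^ 2 * D) * p" by (simp add: ac_simps)
    thus ?thesis using p_gt_2 by simp
  qed
  have "card (\<Union>j\<in>J. bad j) \<le> (\<Sum>j\<in>J. card (bad j))" by (rule card_UN_le) (rule insert.hyps)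
  also have "\<dots> \<le> (\<Sum>j\<in>J. L ^ 2 * D)" by (rule sum_mono) (rule card_bad)
  finally have cb: "card (\<Union>j\<in>J. bad j) \<le> n * (L ^ 2 * D)" by (simp add: n_def)
  have "\<not> A k \<subseteq> (\<Union>j\<in>J. bad j)"
  proof
    assume "A k \<subseteq> (\<Union>j\<in>J. bad j)"
    hence "card (A k) \<le> n * (L ^ 2 * D)"
      using card_mono[of "\<Union>j\<in>J. bad j" "A k"] cb fbad insert.hyps by simp
    hence "card (A k) * D \<le> n * (L ^ 2 * D) * D" by (rule mult_right_mono) simp
    hence "p \<le> n * (L ^ 2 * D) * D" using insert.prems(3)[of k] by (meson insertI1 le_trans)
    also have "\<dots> = n * L ^ 2 * D ^ 2" by (simp add: power2_eq_square)
    also have "\<dots> \<le> Suc n * L ^ 2 * (D * L ^ Suc n) ^ 2"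
      using L1 by (intro mult_mono power_mono) auto
    finally show False using big by simp
  qed
  then obtain x where x: "x \<in> A k" "\<And>j. j \<in> J \<Longrightarrow> x \<notin> bad j" by blast
  have xX: "x \<in> Zp" using x insert.prems(2)[of k] by blast
  \<comment> \<open>Restricting every other candidate set to its hits settles all constraints
    involving \<open>k\<close>; the induction hypothesis handles the rest with \<open>D * L\<close>
    in place of \<open>D\<close>.\<close>
  define A' where "A' = (\<lambda>j. hits (A j) (c k j) x)"
  have "\<exists>\<phi>. \<forall>i\<in>J. \<phi> i \<in> A' i \<and> (\<forall>j\<in>J. i \<noteq> j \<longrightarrow> \<phi> i \<noteq> \<phi> j \<and> cl (\<phi> i - \<phi> j) = c i j)"
  proof (rule insert.IH)
    show "1 \<le> D * L" using insert.prems(1) L1 by (simp add: Suc_le_eq)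
    show "A' j \<subseteq> Zp" if "j \<in> J" for j using insert.prems(2)[of j] that by (auto simp: A'_def hits_def)
    show "p \<le> card (A' j) * (D * L)" if "j \<in> J" for j
    proof -
      have "p \<le> card (A j) * D" using insert.prems(3)[of j] that by simp
      also have "card (A j) \<le> L * card (A' j)"
        using x(2)[OF that] xX by (auto simp: bad_def A'_def L_def)
      finally show ?thesis by (simp add: ac_simps)
    qed
    \<comment> \<open>The product of the density parameter and \<open>L\<close> to the number of
      unplaced vertices is the same before and after a placement, so one lower bound on
      \<open>p\<close> lasts through the whole induction.\<close>
    have "card J * (2 * m) ^ 2 * (D * L * (2 * m) ^ card J) ^ 2 = n * L ^ 2 * (D * L ^ Suc n) ^ 2"
      by (simp add: n_def L_def ac_simps)
    also have "\<dots> \<le> Suc n * L ^ 2 * (D * L ^ Suc n) ^ 2" by (intro mult_right_mono) auto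
    finally show "card J * (2 * m) ^ 2 * (D * L * (2 * m) ^ card J) ^ 2 < p" using big by simp
  qed
  then obtain \<phi> where \<phi>: "\<And>i. i \<in> J \<Longrightarrow> \<phi> i \<in> A' i"
      "\<And>i j. i \<in> J \<Longrightarrow> j \<in> J \<Longrightarrow> i \<noteq> j \<Longrightarrow> \<phi> i \<noteq> \<phi> j \<and> cl (\<phi> i - \<phi> j) = c i j"
    by blast
  have new: "\<phi> j \<in> A j" "\<phi> j \<noteq> x" "cl (x - \<phi> j) = c k j" "cl (\<phi> j - x) = c j k" if "j \<in> J" for j
  proof -
    show 1: "\<phi> j \<in> A j" "\<phi> j \<noteq> x" "cl (x - \<phi> j) = c k j" using \<phi>(1)[OF that] by (auto simp: A'_def hits_def)
    have "\<phi> j \<in> Zp" using 1(1) insert.prems(2)[of j] that by blast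
    hence "\<not> int p dvd x - \<phi> j" using Zp_dvd_diff_iff xX 1(2) by blast
    thus "cl (\<phi> j - x) = c j k" using cl_uminus[of "x - \<phi> j"] 1(3) c(2) by simp
  qed
  define \<psi> where "\<psi> = \<phi>(k := x)"
  have \<psi>: "\<psi> k = x" "\<And>j. j \<in> J \<Longrightarrow> \<psi> j = \<phi> j"
    using insert.hyps by (auto simp: \<psi>_def)
  show ?case
  proof (intro exI[of _ \<psi>] ballI conjI impI)
    fix i assume i: "i \<in> insert k J"
    show "\<psi> i \<in> A i" using i \<psi> new(1) x(1) by fastforce
    fix j assume j: "j \<in> insert k J" "i \<noteq> j"
    consider "i = k" "j \<in> J" | "j = k" "i \<in> J" | "i \<in> J" "j \<in> J" using i j by blast
    then have "\<psi> i \<noteq> \<psi> j \<and> cl (\<psi> i - \<psi> j) = c i j"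
    proof cases
      case 1
      with new(2,3)[of j] \<psi> show ?thesis by simp
    next
      case 2
      with new(2,4)[of i] \<psi> show ?thesis by simp
    next
      case 3
      with \<phi>(2) \<psi> j(2) show ?thesis by simp
    qed
    thus "\<psi> i \<noteq> \<psi> j" "cl (\<psi> i - \<psi> j) = c i j" by blast+
  qed
qed simp

section \<open>Affine maps with \<open>m\<close>-th power multipliers and their orbits on
  arcs\<close>

definition affine :: "nat \<Rightarrow> int \<Rightarrow> int \<Rightarrow> int" where
  "affine j b x = (int g ^ (m * j) * x + b) mod int p"

lemma affine_in_Zp: "affine j b x \<in> Zp"
  using p_gt_2 by (simp add: affine_def Zp_def)

lemma affine_0_0: "x \<in> Zp \<Longrightarrow> affine 0 0 x = x"
  by (simp add: affine_def Zp_def)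

text \<open>The translations cancel in the differences, leaving only the multipliers.\<close>

lemma affine_diff_cong:
  assumes "affine j b x = affine k d x'" "affine j b y = affine k d y'"
  shows "[int g ^ (m * j) * (x - y) = int g ^ (m * k) * (x' - y')] (mod int p)"
proof -
  have "[int g ^ (m * j) * x + b = int g ^ (m * k) * x' + d] (mod int p)"
    "[int g ^ (m * j) * y + b = int g ^ (m * k) * y' + d] (mod int p)"
    using assms by (simp_all add: affine_def cong_def)
  from cong_diff[OF this] show ?thesis by (simp add: algebra_simps)
qed

lemma inj_on_affine: "inj_on (affine j b) Zp"
proof (rule inj_onI)
  fix x y assume "x \<in> Zp" "y \<in> Zp" "affine j b x = affine j b y"
  have "[int g ^ (m * j) * (x - y) = int g ^ (m * j) * (y - y)] (mod int p)"
    by (rule affine_diff_cong) (use \<open>affine j b x = affine j b y\<close> in simp_all)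
  hence "int p dvd int g ^ (m * j) * (x - y)" by (simp add: cong_0_iff)
  hence "int p dvd x - y" using not_dvd_g prime_int_p prime_dvd_mult_iff by blast
  thus "x = y" using \<open>x \<in> Zp\<close> \<open>y \<in> Zp\<close> Zp_dvd_diff_iff by blast
qed

lemma cl_power_mult:
  assumes "\<not> int p dvd z"
  shows "cl (int g ^ (m * j) * z) = cl z"
proof -
  have "[int g ^ (m * j) * z = int g ^ (m * j + dlog z)] (mod int p)"
    unfolding power_add by (intro cong_mult cong_refl dlog_props assms)
  from cl_eqI[OF this] show ?thesis by (simp add: cl_def)
qed

lemma cl_cong:
  assumes "[z = w] (mod int p)" "\<not> int p dvd w"
  shows "cl z = cl w"
  using cl_eqI[OF cong_trans[OF assms(1) dlog_props(2)[OF assms(2)]]] by (simp add: cl_def)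

text \<open>The factor \<open>z\<close> cancels, and exponents below \<open>m * h\<close>, the order
  of \<open>g\<close>, are determined by the power.\<close>

lemma power_cong_imp_eq:
  assumes "\<not> int p dvd z" "[int g ^ (m * j) * z = int g ^ (m * k) * z] (mod int p)" "j < h" "k < h"
  shows "j = k"
proof -
  have "int p dvd (int g ^ (m * j) - int g ^ (m * k)) * z"
    using assms(2) by (simp add: cong_iff_dvd_diff algebra_simps)
  hence "int p dvd int g ^ (m * j) - int g ^ (m * k)"
    using assms(1) prime_int_p prime_dvd_mult_iff by blast
  hence "[m * j = m * k] (mod m * h)"
    by (simp only: flip: cong_iff_dvd_diff power_cong_iff p_minus_1)
  moreover have "m * j < m * h" "m * k < m * h" using assms(3,4) m_pos by simp_all
  ultimately show ?thesis using m_pos by (simp add: cong_def)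
qed

text \<open>
  \<open>j\<close> runs only up to \<open>h div 2\<close>: since \<open>-1 = g ^ (m * (h div 2))\<close>, the other half of the \<open>m\<close>-th powers
  would produce every arc a second time, from the reversed arc of \<open>E\<close>.
\<close>

lemma affine_orbits:
  fixes \<phi> :: "'v \<Rightarrow> int" and E :: "('v \<times> 'v) set"
  assumes finE: "finite E" and cardE: "card E = 2 * m"
    and \<phi>: "\<And>u w. (u, w) \<in> E \<Longrightarrow> \<phi> u \<in> Zp \<and> \<phi> w \<in> Zp \<and> \<phi> u \<noteq> \<phi> w"
    and cl: "\<And>u w u' w'. (u, w) \<in> E \<Longrightarrow> (u', w') \<in> E \<Longrightarrow>
      cl (\<phi> u - \<phi> w) = cl (\<phi> u' - \<phi> w') \<Longrightarrow> {u, w} = {u', w'}"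
  shows "bij_betw (\<lambda>((j, b), (u, w)). (affine j b (\<phi> u), affine j b (\<phi> w)))
    (({..<h div 2} \<times> Zp) \<times> E) {(x, y). x \<in> Zp \<and> y \<in> Zp \<and> x \<noteq> y}" (is "bij_betw ?F ?D ?R")
proof -
  have nd: "\<not> int p dvd \<phi> u - \<phi> w" if "(u, w) \<in> E" for u w
    using \<phi>[OF that] Zp_dvd_diff_iff by blast
  have inj: "inj_on ?F ?D"
  proof (rule inj_onI)
    fix s t assume s: "s \<in> ?D" and t: "t \<in> ?D" and eq: "?F s = ?F t"
    obtain j b u w where s': "s = ((j, b), (u, w))" by (metis surj_pair)
    obtain k d u' w' where t': "t = ((k, d), (u', w'))" by (metis surj_pair)
    have E: "(u, w) \<in> E" "(u', w') \<in> E" and jk: "j < h div 2" "k < h div 2" and bd: "b \<in> Zp" "d \<in> Zp"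
      using s t by (simp_all add: s' t')
    have Teq: "affine j b (\<phi> u) = affine k d (\<phi> u')" "affine j b (\<phi> w) = affine k d (\<phi> w')"
      using eq by (simp_all add: s' t')
    have c: "[int g ^ (m * j) * (\<phi> u - \<phi> w) = int g ^ (m * k) * (\<phi> u' - \<phi> w')] (mod int p)"
      by (rule affine_diff_cong[OF Teq])
    have "cl (\<phi> u - \<phi> w) = cl (int g ^ (m * j) * (\<phi> u - \<phi> w))"
      by (rule cl_power_mult[symmetric, OF nd[OF E(1)]])
    also have "\<dots> = cl (int g ^ (m * k) * (\<phi> u' - \<phi> w'))"
      by (rule cl_cong[OF c]) (use nd[OF E(2)] not_dvd_g prime_int_p prime_dvd_mult_iff in blast)
    also have "\<dots> = cl (\<phi> u' - \<phi> w')" by (rule cl_power_mult[OF nd[OF E(2)]])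
    finally have "{u, w} = {u', w'}" using cl E by blast
    then consider "u = u'" "w = w'" | "u = w'" "w = u'" by (auto simp: doubleton_eq_iff)
    thus "s = t"
    proof cases
      case 1
      have "j = k" by (rule power_cong_imp_eq[OF nd[OF E(1)]]) (use c 1 jk in simp_all)
      hence "[b = d] (mod int p)"
        using Teq(1) 1 by (simp add: affine_def cong_def[symmetric] cong_add_lcancel)
      hence "b = d" using bd Zp_dvd_diff_iff by (simp add: cong_iff_dvd_diff)
      thus ?thesis using 1 \<open>j = k\<close> by (simp add: s' t')
    next
      case 2
      \<comment> \<open>A reversed edge contributes a factor -1, which is the \<open>m\<close>-th
        power with exponent \<open>m * (h div 2)\<close>. This shifts \<open>k\<close> by
        \<open>h div 2\<close>, out of the range allowed for \<open>j\<close>.\<close>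
      have "[int g ^ (m * k) * (-1 * (\<phi> u - \<phi> w))
          = int g ^ (m * k) * (int g ^ (m * (h div 2)) * (\<phi> u - \<phi> w))] (mod int p)"
        by (intro cong_mult cong_refl cong_sym[OF power_half])
      hence "[int g ^ (m * j) * (\<phi> u - \<phi> w) = int g ^ (m * (k + h div 2)) * (\<phi> u - \<phi> w)] (mod int p)"
        using c 2 by (simp add: power_add distrib_left mult.assoc) (metis cong_trans)
      hence "j = k + h div 2"
        by (rule power_cong_imp_eq[OF nd[OF E(1)]]) (use jk in linarith)+
      thus ?thesis using jk by simp
    qed
  qed
  have sub: "?F ` ?D \<subseteq> ?R"
  proof (rule image_subsetI)
    fix s assume s: "s \<in> ?D"
    obtain j b u w where s': "s = ((j, b), (u, w))" by (metis surj_pair)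
    have "(u, w) \<in> E" using s by (simp add: s')
    hence "affine j b (\<phi> u) \<noteq> affine j b (\<phi> w)" using inj_on_affine \<phi> by (metis inj_onD)
    thus "?F s \<in> ?R" using affine_in_Zp by (simp add: s')
  qed
  have finR: "finite ?R" by (rule finite_subset[of _ "Zp \<times> Zp"]) (auto simp: finite_Zp)
  \<comment> \<open>Surjectivity follows by counting: both sides have \<open>p * (m * h)\<close>
    elements.\<close>
  have "card ?R = card (SIGMA x:Zp. Zp - {x})" by (rule arg_cong[of _ _ card]) auto
  also have "\<dots> = (\<Sum>x\<in>Zp. m * h)" using finite_Zp
    by (subst card_SigmaI) (auto simp: card_Zp_remove simp del: card_Diff_insert intro!: sum.cong)
  also have "\<dots> = p * (m * h)" by (simp add: card_Zp)
  also have "\<dots> = h div 2 * p * (2 * m)"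
    using even_h by (metis dvd_div_mult_self mult.assoc mult.commute)
  also have "\<dots> = card ?D" by (simp add: card_cartesian_product card_Zp cardE)
  also have "\<dots> = card (?F ` ?D)" by (rule card_image[OF inj, symmetric])
  finally have "?F ` ?D = ?R" using sub finR by (intro card_subset_eq) simp_all
  thus ?thesis using inj by (simp add: bij_betw_def)
qed

end

section \<open>Graphs and their designs\<close>

lemma pair_graph_iff:
  "pair_graph G \<longleftrightarrow> finite (pverts G) \<and> parcs G \<subseteq> pverts G \<times> pverts G \<and> sym (parcs G) \<and> irrefl (parcs G)"
proof
  assume "pair_graph G"
  then interpret pair_graph G .
  show "finite (pverts G) \<and> parcs G \<subseteq> pverts G \<times> pverts G \<and> sym (parcs G) \<and> irrefl (parcs G)"
    using pair_finite_verts in_arcsD1 in_arcsD2 arcs_symmetric no_loops'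
    by (auto intro: symI simp: irrefl_def, blast)
next
  assume R: "finite (pverts G) \<and> parcs G \<subseteq> pverts G \<times> pverts G \<and> sym (parcs G) \<and> irrefl (parcs G)"
  hence "finite (parcs G)" by (meson finite_SigmaI finite_subset)
  with R show "pair_graph G"
    by unfold_locales (auto simp: symmetric_def irrefl_def)
qed

lemma pair_wf_digraph_pair_graph: "pair_graph G \<Longrightarrow> wf_digraph (with_proj G)"
  by (simp add: wf_digraph_wp_iff pair_graph_def pair_digraph_def pair_fin_digraph_def)

lemma subgraph_pair_graph_iff:
  assumes "pair_graph H" "pair_graph G"
  shows "subgraph (with_proj H) (with_proj G) \<longleftrightarrow> pverts H \<subseteq> pverts G \<and> parcs H \<subseteq> parcs G"
  using assms by (simp add: subgraph_def compatible_def pair_wf_digraph_pair_graph)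

section \<open>Transport of graphs along injective vertex maps\<close>

definition map_graph :: "('a \<Rightarrow> 'b) \<Rightarrow> 'a pair_pre_digraph \<Rightarrow> 'b pair_pre_digraph" where
  "map_graph f G = \<lparr> pverts = f ` pverts G, parcs = map_prod f f ` parcs G \<rparr>"

lemma map_graph_simps [simp]:
  "pverts (map_graph f G) = f ` pverts G"
  "parcs (map_graph f G) = map_prod f f ` parcs G"
  by (simp_all add: map_graph_def)

lemma pair_graph_map_graph:
  assumes "pair_graph G" "inj_on f (pverts G)"
  shows "pair_graph (map_graph f G)"
  using assms unfolding pair_graph_iff
  by (auto simp: irrefl_def inj_on_def intro!: symI dest: symD) (blast dest: symD)+

lemma map_graph_ident:
  assumes "pair_graph G" "\<And>x. x \<in> pverts G \<Longrightarrow> f x = x"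
  shows "map_graph f G = G"
proof (rule pair_pre_digraph.equality)
  have "map_prod f f a = a" if "a \<in> parcs G" for a
    using assms that unfolding pair_graph_iff by (cases a) auto
  thus "parcs (map_graph f G) = parcs G" by simp
qed (use assms in simp_all)

text \<open>Tail and head are the two projections on both sides, so the arc map of an isomorphism is
  forced by its vertex map.\<close>

lemma digraph_iso_pair_graph_iff:
  assumes "pair_graph G"
  shows "digraph_iso (with_proj G) (with_proj H) \<longleftrightarrow> (\<exists>f. inj_on f (pverts G) \<and> H = map_graph f G)"
proof
  assume "digraph_iso (with_proj G) (with_proj H)"
  then obtain k where k: "pre_digraph.digraph_isomorphism (with_proj G) k" "with_proj H = app_iso k (with_proj G)"
    unfolding digraph_iso_def by blast
  have H: "pverts H = iso_verts k ` pverts G" "parcs H = iso_arcs k ` parcs G"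
    "iso_tail k = fst" "iso_head k = snd"
    using arg_cong[OF k(2), of verts] arg_cong[OF k(2), of arcs]
      arg_cong[OF k(2), of tail] arg_cong[OF k(2), of head] by simp_all
  have "iso_arcs k a = map_prod (iso_verts k) (iso_verts k) a" if "a \<in> parcs G" for a
    using k(1) that H(3,4) unfolding pre_digraph.digraph_isomorphism_def
    by (cases a) (auto simp: prod_eq_iff)
  hence "H = map_graph (iso_verts k) G"
    using H by (intro pair_pre_digraph.equality) auto
  thus "\<exists>f. inj_on f (pverts G) \<and> H = map_graph f G"
    using k(1) unfolding pre_digraph.digraph_isomorphism_def by auto
next
  assume "\<exists>f. inj_on f (pverts G) \<and> H = map_graph f G"
  then obtain f where f: "inj_on f (pverts G)" "H = map_graph f G" by blast
  define k where "k = \<lparr> iso_verts = f, iso_arcs = map_prod f f, iso_head = snd, iso_tail = fst \<rparr>"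
  have "inj_on (map_prod f f) (parcs G)"
    using map_prod_inj_on[OF f(1) f(1)] assms inj_on_subset unfolding pair_graph_iff by blast
  hence "pre_digraph.digraph_isomorphism (with_proj G) k"
    using f(1) pair_wf_digraph_pair_graph[OF assms]
    by (simp add: pre_digraph.digraph_isomorphism_def k_def)
  moreover have "with_proj H = app_iso k (with_proj G)"
    by (simp add: with_proj_def app_iso_def k_def f(2))
  ultimately show "digraph_iso (with_proj G) (with_proj H)" unfolding digraph_iso_def by blast
qed

lemma digraph_iso_map_graph:
  assumes "pair_graph G" "inj_on f (pverts G)" "digraph_iso (with_proj G) (with_proj H)"
  shows "digraph_iso (with_proj (map_graph f G)) (with_proj H)"
proof -
  have "digraph_iso (with_proj G) (with_proj (map_graph f G))"
    using assms(1,2) digraph_iso_pair_graph_iff by blast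
  thus ?thesis
    by (rule digraph_iso_trans[OF digraph_iso_swap[OF pair_wf_digraph_pair_graph[OF assms(1)]] assms(3)])
qed

text \<open>The subgraph of \<open>\<Gamma>\<close> isomorphic to \<open>\<Gamma>'\<close> is pulled
  back along the isomorphism from the block to \<open>\<Gamma>\<close>.\<close>

lemma graph_le_copy_in_block:
  fixes B :: "'v pair_pre_digraph"
  assumes le: "graph_le \<Gamma>' \<Gamma>" and B: "pair_graph B" and iso: "digraph_iso (with_proj B) (with_proj \<Gamma>)"
  shows "\<exists>B'. pair_graph B' \<and> pverts B' \<subseteq> pverts B \<and> parcs B' \<subseteq> parcs B \<and>
    digraph_iso (with_proj B') (with_proj \<Gamma>')"
proof -
  obtain f where f: "inj_on f (pverts B)" "\<Gamma> = map_graph f B"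
    using iso digraph_iso_pair_graph_iff[OF B] by blast
  obtain H where H: "pair_graph H" "subgraph (with_proj H) (with_proj \<Gamma>)"
      "digraph_iso (with_proj H) (with_proj \<Gamma>')"
    using le unfolding graph_le_def by blast
  have sub: "pverts H \<subseteq> f ` pverts B" "parcs H \<subseteq> map_prod f f ` parcs B"
    using H(2) by (simp_all add: subgraph_def f(2))
  define r where "r = the_inv_into (pverts B) f"
  have r: "r (f x) = x" if "x \<in> pverts B" for x
    using f(1) that by (simp add: r_def the_inv_into_f_f)
  have inj: "inj_on r (pverts H)"
    using sub(1) r by (intro inj_onI) (metis imageE subsetD)
  have "map_prod r r ` parcs H \<subseteq> map_prod r r ` map_prod f f ` parcs B" using sub(2) by blast
  also have "\<dots> = parcs (map_graph (r \<circ> f) B)" by (simp add: image_comp map_prod_compose)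
  also have "map_graph (r \<circ> f) B = B" by (rule map_graph_ident[OF B]) (simp add: r)
  finally have "parcs (map_graph r H) \<subseteq> parcs B" by simp
  moreover have "pverts (map_graph r H) \<subseteq> pverts B" using sub(1) r by auto
  ultimately show ?thesis
    using pair_graph_map_graph[OF H(1) inj] digraph_iso_map_graph[OF H(1) inj H(3)] by blast
qed

section \<open>Developing edge-disjoint copies into a design of prime order\<close>

lemma orbit_design:
  fixes P :: "'v pair_pre_digraph set" and S :: "'i \<Rightarrow> 'v \<Rightarrow> 'w"
  assumes P: "\<And>B. B \<in> P \<Longrightarrow> pair_graph B \<and> pverts B \<subseteq> V \<and> digraph_iso (with_proj B) (with_proj \<Gamma>)"
    and disj: "disjoint_family_on parcs P"
    and S: "\<And>i. i \<in> I \<Longrightarrow> inj_on (S i) V \<and> S i ` V \<subseteq> W"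
    and bij: "bij_betw (\<lambda>(i, (u, w)). (S i u, S i w)) (I \<times> (\<Union>B\<in>P. parcs B)) {(x, y). x \<in> W \<and> y \<in> W \<and> x \<noteq> y}"
    and W: "finite W" "card W = n" "n > 0"
  shows "design_of_order n \<Gamma> ((\<lambda>(i, B). map_graph (S i) B) ` (I \<times> P))"
proof -
  define K where "K = \<lparr> pverts = W, parcs = {(x, y). x \<in> W \<and> y \<in> W \<and> x \<noteq> y} \<rparr>"
  have K: "complete_digraph n (with_proj K)"
    unfolding complete_digraph_pair_def using W by (auto simp: K_def)
  hence pK: "pair_graph K" by (rule pair_graphI_complete)
  have arcs_eq: "(\<Union>B\<in>(\<lambda>(i, B). map_graph (S i) B) ` (I \<times> P). parcs B) = parcs K"
  proof -
    have "(\<Union>B\<in>(\<lambda>(i, B). map_graph (S i) B) ` (I \<times> P). parcs B)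
        = (\<lambda>(i, (u, w)). (S i u, S i w)) ` (I \<times> (\<Union>B\<in>P. parcs B))"
      by (force simp: image_iff)
    also have "\<dots> = parcs K" using bij_betw_imp_surj_on[OF bij] by (simp add: K_def)
    finally show ?thesis .
  qed
  have blocks: "pair_graph (map_graph (S i) B)"
      "subgraph (with_proj (map_graph (S i) B)) (with_proj K)"
      "digraph_iso (with_proj (map_graph (S i) B)) (with_proj \<Gamma>)"
    if "i \<in> I" "B \<in> P" for i B
  proof -
    have inj: "inj_on (S i) (pverts B)" using S[OF that(1)] P[OF that(2)] inj_on_subset by blast
    show pg: "pair_graph (map_graph (S i) B)" using P[OF that(2)] inj pair_graph_map_graph by blast
    show "digraph_iso (with_proj (map_graph (S i) B)) (with_proj \<Gamma>)"
      using P[OF that(2)] inj digraph_iso_map_graph by blast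
    have "parcs (map_graph (S i) B) \<subseteq> parcs K" unfolding arcs_eq[symmetric] using that by force
    moreover have "pverts (map_graph (S i) B) \<subseteq> pverts K"
      using S[OF that(1)] P[OF that(2)] by (auto simp: K_def)
    ultimately show "subgraph (with_proj (map_graph (S i) B)) (with_proj K)"
      using subgraph_pair_graph_iff[OF pg pK] by blast
  qed
  \<comment> \<open>The blocks form a set indexed by itself, so disjointness means that two blocks
    with a common arc are equal. By \<open>bij\<close> the arc determines the map and the original
    arc, and the latter lies in only one member of \<open>P\<close>.\<close>
  have same: "map_graph (S i) B = map_graph (S i') B'"
    if i: "i \<in> I" "i' \<in> I" "B \<in> P" "B' \<in> P"
      and a: "a \<in> parcs (map_graph (S i) B)" "a \<in> parcs (map_graph (S i') B')" for i i' B B' a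
  proof -
    obtain u w where u: "(u, w) \<in> parcs B" "a = (S i u, S i w)" using a(1) by auto
    obtain u' w' where u': "(u', w') \<in> parcs B'" "a = (S i' u', S i' w')" using a(2) by auto
    have "(i, (u, w)) = (i', (u', w'))"
      by (rule inj_onD[OF bij_betw_imp_inj_on[OF bij]]) (use i u u' in auto)
    moreover from this have "B = B'" using disj u(1) u'(1) i unfolding disjoint_family_on_def by blast
    ultimately show ?thesis by simp
  qed
  have "disjoint_family_on parcs ((\<lambda>(i, B). map_graph (S i) B) ` (I \<times> P))"
    unfolding disjoint_family_on_def using same by fast
  hence "graph_design K \<Gamma> ((\<lambda>(i, B). map_graph (S i) B) ` (I \<times> P))"
    unfolding graph_design_def using arcs_eq blocks by auto
  thus ?thesis unfolding design_of_order_def using K W by blast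
qed

lemma card_sym_eq_twice_card_edges:
  fixes E :: "('a \<times> 'a) set"
  assumes "finite E" "sym E" "irrefl E"
  shows "card E = 2 * card ((\<lambda>(u, w). {u, w}) ` E)"
proof -
  define q where "q = (\<lambda>(u :: 'a, w). {u, w})"
  have fib: "card {a \<in> E. q a = e} = 2" if "e \<in> q ` E" for e
  proof -
    from that obtain u w where uw: "(u, w) \<in> E" "e = {u, w}"
      unfolding q_def by auto
    have "u \<noteq> w" using uw assms(3) by (auto simp: irrefl_def)
    have "{a \<in> E. q a = e} = {(u, w), (w, u)}"
      using uw assms(2) by (auto simp: q_def doubleton_eq_iff dest: symD)
    thus ?thesis using \<open>u \<noteq> w\<close> by simp
  qed
  have "E = (\<Union>e\<in>q ` E. {a \<in> E. q a = e})" by blast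
  also have "card \<dots> = (\<Sum>e\<in>q ` E. card {a \<in> E. q a = e})"
    by (rule card_UN_disjoint) (use assms(1) in auto)
  also have "\<dots> = 2 * card (q ` E)" using fib by simp
  finally show ?thesis by (simp add: q_def)
qed

text \<open>Serves to carry the field back into the vertex universe with every vertex of
  \<open>V\<close> returning to its old place. The remaining field elements go to fresh vertices,
  which exist because the universe is infinite.\<close>

lemma extend_inverse_injection:
  fixes \<phi> :: "'v::infinite \<Rightarrow> 'b"
  assumes "finite V" "finite Y" "inj_on \<phi> V" "\<phi> ` V \<subseteq> Y"
  shows "\<exists>\<psi>. inj_on \<psi> Y \<and> (\<forall>x\<in>V. \<psi> (\<phi> x) = x)"
proof -
  have "infinite (- V)" using assms(1) infinite_UNIV by (metis Compl_eq_Diff_UNIV Diff_infinite_finite)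
  then obtain W where W: "W \<subseteq> - V" "finite W" "card W = card (Y - \<phi> ` V)"
    using infinite_arbitrarily_large by blast
  then obtain \<beta> where \<beta>: "bij_betw \<beta> (Y - \<phi> ` V) W"
    using assms(2) by (metis finite_Diff finite_same_card_bij)
  define \<psi> where "\<psi> = (\<lambda>y. if y \<in> \<phi> ` V then the_inv_into V \<phi> y else \<beta> y)"
  have \<psi>\<phi>: "\<psi> (\<phi> x) = x" if "x \<in> V" for x
    using that assms(3) by (simp add: \<psi>_def the_inv_into_f_f)
  have \<psi>\<beta>: "\<psi> y = \<beta> y" "\<beta> y \<in> W" if "y \<in> Y" "y \<notin> \<phi> ` V" for y
    using that \<beta> by (auto simp: \<psi>_def bij_betw_def)
  have "inj_on \<psi> Y"
  proof (rule inj_onI)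
    fix y z assume yz: "y \<in> Y" "z \<in> Y" "\<psi> y = \<psi> z"
    have V: "\<psi> t \<in> V \<longleftrightarrow> t \<in> \<phi> ` V" if "t \<in> Y" for t
    proof
      assume "\<psi> t \<in> V"
      thus "t \<in> \<phi> ` V" using \<psi>\<beta>[OF that] W(1) by (cases "t \<in> \<phi> ` V") auto
    qed (use \<psi>\<phi> in auto)
    show "y = z"
    proof (cases "y \<in> \<phi> ` V")
      case True
      moreover have "z \<in> \<phi> ` V" using True V yz by metis
      ultimately show ?thesis using \<psi>\<phi> yz(3) by auto
    next
      case False
      moreover have "z \<notin> \<phi> ` V" using False V yz by metis
      ultimately have "\<beta> y = \<beta> z" using \<psi>\<beta>(1) yz by simp
      thus ?thesis
        using inj_onD[OF bij_betw_imp_inj_on[OF \<beta>]] False \<open>z \<notin> \<phi> ` V\<close> yz by blast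
    qed
  qed
  thus ?thesis using \<psi>\<phi> by blast
qed

text \<open>The edges of \<open>P\<close> are placed so that their differences represent all
  \<open>m\<close> cosets. The affine images then cover every arc on \<open>p\<close> vertices once,
  and the identity map keeps \<open>P\<close> among the blocks.\<close>

lemma partial_design_embeds:
  fixes P :: "'v::infinite pair_pre_digraph set" and p m :: nat
  defines "E \<equiv> \<Union>B\<in>P. parcs B"
  assumes V: "finite V"
    and P: "\<And>B. B \<in> P \<Longrightarrow> pair_graph B \<and> pverts B \<subseteq> V \<and> digraph_iso (with_proj B) (with_proj \<Gamma>)"
    and disj: "disjoint_family_on parcs P"
    and m: "m = card ((\<lambda>(u, w). {u, w}) ` E)" "m > 0"
    and p: "prime p" "2 * m dvd p - 1" "p > card V * (2 * m) ^ 2 * ((2 * m) ^ card V) ^ 2"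
  shows "\<exists>\<B>. design_of_order p \<Gamma> \<B> \<and> P \<subseteq> \<B>"
proof -
  obtain g where "residue_primroot p g" using prime_primitive_root_exists p(1) prime_gt_1_nat by blast
  then interpret cyclotomic p g m using p m(2) by unfold_locales
  have E: "E \<subseteq> V \<times> V" "sym E" "irrefl E"
    using P unfolding E_def pair_graph_iff sym_def irrefl_def by blast+
  have finE: "finite E" using E(1) V by (meson finite_SigmaI finite_subset)
  define U where "U = (\<lambda>(u, w). {u, w}) ` E"
  have "finite U" using finE by (simp add: U_def)
  then obtain \<iota> where \<iota>: "bij_betw \<iota> U {0..<m}"
    using ex_bij_betw_finite_nat m(1) unfolding U_def by blast
  \<comment> \<open>The numbering \<open>\<iota>\<close> gives each edge a class of its own. Class 0
    for non-edges is a default; the orbits compare only differences along edges.\<close>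
  define c where "c = (\<lambda>u w. if {u, w} \<in> U then \<iota> {u, w} else 0)"
  have c_less: "c u w < m" for u w
    using \<iota> m(2) by (auto simp: c_def bij_betw_def)
  have c_sym: "c u w = c w u" for u w by (simp add: c_def insert_commute)
  \<comment> \<open>All of \<open>Zp\<close> is initially available to every vertex, hence
    \<open>D = 1\<close>.\<close>
  have "\<exists>\<phi>. \<forall>i\<in>V. \<phi> i \<in> Zp \<and> (\<forall>j\<in>V. i \<noteq> j \<longrightarrow> \<phi> i \<noteq> \<phi> j \<and> cl (\<phi> i - \<phi> j) = c i j)"
    by (rule greedy_embedding[where D = 1]) (use V p(3) c_less c_sym in \<open>simp_all add: card_Zp\<close>)
  then obtain \<phi> where \<phi>: "\<And>i. i \<in> V \<Longrightarrow> \<phi> i \<in> Zp"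
      "\<And>i j. i \<in> V \<Longrightarrow> j \<in> V \<Longrightarrow> i \<noteq> j \<Longrightarrow> \<phi> i \<noteq> \<phi> j \<and> cl (\<phi> i - \<phi> j) = c i j"
    by blast
  have inj\<phi>: "inj_on \<phi> V" using \<phi>(2) by (meson inj_onI)
  obtain \<psi> where \<psi>: "inj_on \<psi> Zp" "\<And>x. x \<in> V \<Longrightarrow> \<psi> (\<phi> x) = x"
    using extend_inverse_injection[OF V finite_Zp inj\<phi>] \<phi>(1) by blast
  have EV: "u \<in> V" "w \<in> V" "u \<noteq> w" if "(u, w) \<in> E" for u w
    using that E by (auto simp: irrefl_def)
  have orbits: "bij_betw (\<lambda>((j, b), (u, w)). (affine j b (\<phi> u), affine j b (\<phi> w)))
      (({..<h div 2} \<times> Zp) \<times> E) {(x, y). x \<in> Zp \<and> y \<in> Zp \<and> x \<noteq> y}"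
  proof (rule affine_orbits[OF finE])
    show "card E = 2 * m" unfolding m(1) by (rule card_sym_eq_twice_card_edges[OF finE E(2,3)])
    show "\<phi> u \<in> Zp \<and> \<phi> w \<in> Zp \<and> \<phi> u \<noteq> \<phi> w" if "(u, w) \<in> E" for u w
      using \<phi> EV[OF that] by blast
    show "{u, w} = {u', w'}"
      if e: "(u, w) \<in> E" "(u', w') \<in> E" and "cl (\<phi> u - \<phi> w) = cl (\<phi> u' - \<phi> w')" for u w u' w'
    proof -
      have "{u, w} \<in> U" "{u', w'} \<in> U" using e by (force simp: U_def)+
      moreover have "c u w = c u' w'" using that(3) \<phi>(2) EV e by metis
      ultimately show ?thesis
        using inj_onD[OF bij_betw_imp_inj_on[OF \<iota>]] by (simp add: c_def)
    qed
  qed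
  define S where "S = (\<lambda>(j, b) x. \<psi> (affine j b (\<phi> x)))"
  define I where "I = {..<h div 2} \<times> Zp"
  have "bij_betw (map_prod \<psi> \<psi>) {(x, y). x \<in> Zp \<and> y \<in> Zp \<and> x \<noteq> y}
      {(x, y). x \<in> \<psi> ` Zp \<and> y \<in> \<psi> ` Zp \<and> x \<noteq> y}"
    using \<psi>(1) by (force simp: bij_betw_def inj_on_def)
  from bij_betw_trans[OF orbits this]
  have bij: "bij_betw (\<lambda>(i, (u, w)). (S i u, S i w)) (I \<times> (\<Union>B\<in>P. parcs B))
      {(x, y). x \<in> \<psi> ` Zp \<and> y \<in> \<psi> ` Zp \<and> x \<noteq> y}"
    by (simp add: comp_def case_prod_unfold S_def I_def E_def)
  have S: "inj_on (S i) V \<and> S i ` V \<subseteq> \<psi> ` Zp" if "i \<in> I" for i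
  proof -
    obtain j b where i: "i = (j, b)" by fastforce
    have "inj_on (\<psi> \<circ> (affine j b \<circ> \<phi>)) V"
    proof (intro comp_inj_on inj\<phi>)
      show "inj_on (affine j b) (\<phi> ` V)" using inj_on_subset[OF inj_on_affine] \<phi>(1) by blast
      show "inj_on \<psi> ((affine j b \<circ> \<phi>) ` V)" by (intro inj_on_subset[OF \<psi>(1)]) (use affine_in_Zp in \<open>auto simp: comp_def\<close>)
    qed
    thus ?thesis using affine_in_Zp by (auto simp: i S_def comp_def)
  qed
  have "design_of_order p \<Gamma> ((\<lambda>(i, B). map_graph (S i) B) ` (I \<times> P))"
    by (rule orbit_design[OF P disj S bij])
      (use p_gt_2 \<psi>(1) in \<open>simp_all add: finite_Zp card_image card_Zp\<close>)
  moreover have "P \<subseteq> (\<lambda>(i, B). map_graph (S i) B) ` (I \<times> P)"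
  proof
    fix B assume B: "B \<in> P"
    \<comment> \<open>The pair \<open>(0, 0)\<close> belongs to \<open>I\<close> because
      \<open>h\<close> is positive and even. It gives the identity on \<open>V\<close>:
      \<open>affine 0 0\<close> fixes \<open>Zp\<close>, and \<open>\<psi>\<close> undoes
      \<open>\<phi>\<close>.\<close>
    have "h > 0" using p_eq p_gt_2 by (intro Nat.gr0I) auto
    hence "h div 2 > 0" using even_h by (auto elim: evenE)
    moreover have "0 \<in> Zp" using p_gt_2 by (simp add: Zp_def)
    ultimately have "(0, 0) \<in> I" by (simp add: I_def)
    moreover have "map_graph (S (0, 0)) B = B"
      by (rule map_graph_ident) (use P[OF B] \<phi>(1) \<psi>(2) in \<open>auto simp: S_def affine_0_0\<close>)
    ultimately show "B \<in> (\<lambda>(i, B). map_graph (S i) B) ` (I \<times> P)" using B by force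
  qed
  ultimately show ?thesis by blast
qed

lemma card_edges_le:
  assumes "finite V" "E \<subseteq> V \<times> V"
  shows "card ((\<lambda>(u, w). {u, w}) ` E) \<le> 2 ^ card V"
proof -
  have "(\<lambda>(u, w). {u, w}) ` E \<subseteq> Pow V" using assms(2) by auto
  thus ?thesis using assms(1) by (metis card_Pow card_mono finite_Pow_iff)
qed

section \<open>Down-links from all designs of a given order\<close>

text \<open>The conditions on \<open>p\<close> involve only \<open>v\<close>, so one prime serves
  every design of order \<open>v\<close>, as membership in \<open>L2\<close> demands.\<close>

lemma down_link_to_prime_order:
  fixes \<B> :: "'v::infinite pair_pre_digraph set" and p v :: nat
  assumes le: "graph_le \<Gamma>' \<Gamma>" and arcs: "parcs \<Gamma>' \<noteq> {}"
    and v: "v \<ge> 2" and \<B>: "design_of_order v \<Gamma> \<B>"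
    and p: "prime p" "2 * fact (2 ^ v) dvd p - 1" "p > v * (2 * 2 ^ v) ^ 2 * ((2 * 2 ^ v) ^ v) ^ 2"
  shows "\<exists>\<B>' f. design_of_order p \<Gamma>' \<B>' \<and> down_link f \<B> \<B>'"
proof -
  obtain K where K: "complete_digraph v (with_proj K)" and D: "graph_design K \<Gamma> \<B>"
    using \<B> unfolding design_of_order_def by blast
  define V where "V = pverts K"
  have V: "finite V" "card V = v" and parcsK: "parcs K = {(x, y). x \<in> V \<and> y \<in> V \<and> x \<noteq> y}"
    using K unfolding complete_digraph_pair_def V_def by auto
  have blk: "pair_graph B" "subgraph (with_proj B) (with_proj K)" "digraph_iso (with_proj B) (with_proj \<Gamma>)"
    if "B \<in> \<B>" for B using D that unfolding graph_design_def by blast+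
  have "\<forall>B\<in>\<B>. \<exists>B'. pair_graph B' \<and> pverts B' \<subseteq> pverts B \<and> parcs B' \<subseteq> parcs B \<and>
      digraph_iso (with_proj B') (with_proj \<Gamma>')"
    using graph_le_copy_in_block[OF le] blk by blast
  from bchoice[OF this] obtain f where f: "\<forall>B\<in>\<B>. pair_graph (f B) \<and> pverts (f B) \<subseteq> pverts B \<and>
      parcs (f B) \<subseteq> parcs B \<and> digraph_iso (with_proj (f B)) (with_proj \<Gamma>')" ..
  define P where "P = f ` \<B>"
  have P: "pair_graph B \<and> pverts B \<subseteq> V \<and> digraph_iso (with_proj B) (with_proj \<Gamma>')" if "B \<in> P" for B
  proof -
    obtain C where C: "C \<in> \<B>" "B = f C" using \<open>B \<in> P\<close> by (auto simp: P_def)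
    have "pverts C \<subseteq> V" using blk(2)[OF C(1)] by (simp add: subgraph_def V_def)
    with f C show ?thesis by blast
  qed
  have disj: "disjoint_family_on parcs P"
    unfolding disjoint_family_on_def
  proof (intro ballI impI)
    fix B B' assume B: "B \<in> P" "B' \<in> P" "B \<noteq> B'"
    then obtain C C' where C: "C \<in> \<B>" "C' \<in> \<B>" "C \<noteq> C'" "B = f C" "B' = f C'"
      by (auto simp: P_def)
    have "parcs C \<inter> parcs C' = {}"
      using D C unfolding graph_design_def disjoint_family_on_def by blast
    with f C show "parcs B \<inter> parcs B' = {}" by blast
  qed
  define E where "E = (\<Union>B\<in>P. parcs B)"
  have EV: "E \<subseteq> V \<times> V" using P unfolding E_def pair_graph_iff by blast
  define m where "m = card ((\<lambda>(u, w). {u, w}) ` E)"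
  \<comment> \<open>Two vertices of \<open>K\<close> are joined by an arc, so there is a block, and
    its chosen copy of \<open>\<Gamma>'\<close> has an arc.\<close>
  have "m > 0"
  proof -
    have "\<not> card V \<le> 1" using V v by simp
    then obtain x y where "x \<in> V" "y \<in> V" "x \<noteq> y"
      using card_le_Suc0_iff_eq[OF V(1)] by auto
    hence "(x, y) \<in> (\<Union>B\<in>\<B>. parcs B)"
      using D parcsK unfolding graph_design_def by blast
    then obtain B where "B \<in> \<B>" by blast
    hence "f B \<in> P" "pair_graph (f B)" "digraph_iso (with_proj (f B)) (with_proj \<Gamma>')"
      using f by (auto simp: P_def)
    moreover from this obtain k where "\<Gamma>' = map_graph k (f B)"
      using digraph_iso_pair_graph_iff by blast
    ultimately have "E \<noteq> {}" using arcs by (force simp: E_def)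
    moreover have "finite E" using EV V(1) by (meson finite_SigmaI finite_subset)
    ultimately show ?thesis by (simp add: m_def card_gt_0_iff)
  qed
  have m_le: "m \<le> 2 ^ v" using card_edges_le[OF V(1) EV] V(2) by (simp add: m_def)
  have "\<exists>\<B>'. design_of_order p \<Gamma>' \<B>' \<and> P \<subseteq> \<B>'"
  proof (rule partial_design_embeds[OF V(1) P disj])
    show "m = card ((\<lambda>(u, w). {u, w}) ` (\<Union>B\<in>P. parcs B))" by (simp add: m_def E_def)
    \<comment> \<open>The number \<open>m\<close> varies with the design and with the chosen copies;
      the factorial is a common multiple of all its possible values.\<close>
    have "m dvd fact (2 ^ v)" using m_le \<open>m > 0\<close> by (intro dvd_fact) auto
    thus "2 * m dvd p - 1" using p(2) by (meson dvd_trans mult_dvd_mono dvd_refl)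
    have "card V * (2 * m) ^ 2 * ((2 * m) ^ card V) ^ 2 \<le> v * (2 * 2 ^ v) ^ 2 * ((2 * 2 ^ v) ^ v) ^ 2"
      unfolding V(2) using m_le by (intro mult_mono power_mono) auto
    thus "p > card V * (2 * m) ^ 2 * ((2 * m) ^ card V) ^ 2" using p(3) by linarith
  qed (use \<open>m > 0\<close> p(1) in simp_all)
  then obtain \<B>' where "design_of_order p \<Gamma>' \<B>'" "P \<subseteq> \<B>'" by blast
  moreover have "down_link f \<B> \<B>'"
    unfolding down_link_def
    using \<open>P \<subseteq> \<B>'\<close> f blk(1) by (auto simp: P_def subgraph_pair_graph_iff)
  ultimately show ?thesis by blast
qed

text \<open>The complete graph on one vertex has no edges, while every copy of
  \<open>\<Gamma>\<close> has one because \<open>\<Gamma>'\<close> does. The set of blocks is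
  therefore empty and is also a \<open>\<Gamma>'\<close>-design.\<close>

lemma down_link_order_1:
  fixes \<B> :: "'v pair_pre_digraph set"
  assumes \<B>: "design_of_order 1 \<Gamma> \<B>" and le: "graph_le \<Gamma>' \<Gamma>" and arcs: "parcs \<Gamma>' \<noteq> {}"
  shows "design_of_order 1 \<Gamma>' \<B> \<and> down_link id \<B> \<B>"
proof -
  obtain K where K: "complete_digraph 1 (with_proj K)" and D: "graph_design K \<Gamma> \<B>"
    using \<B> unfolding design_of_order_def by blast
  have "parcs K = {}"
    using K unfolding complete_digraph_pair_def by (auto simp: card_1_singleton_iff)
  have "\<B> = {}"
  proof (rule ccontr)
    assume "\<B> \<noteq> {}"
    then obtain B where B: "B \<in> \<B>" by blast
    hence pB: "pair_graph B" and iB: "digraph_iso (with_proj B) (with_proj \<Gamma>)"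
      and "subgraph (with_proj B) (with_proj K)"
      using D unfolding graph_design_def by blast+
    hence "parcs B = {}" using \<open>parcs K = {}\<close> by (simp add: subgraph_def)
    then obtain B' :: "'v pair_pre_digraph"
      where B': "pair_graph B'" "parcs B' = {}" "digraph_iso (with_proj B') (with_proj \<Gamma>')"
      using graph_le_copy_in_block[OF le pB iB] by auto
    then obtain k where "\<Gamma>' = map_graph k B'" using digraph_iso_pair_graph_iff by blast
    thus False using arcs B'(2) by simp
  qed
  thus ?thesis using K \<open>parcs K = {}\<close>
    by (auto simp: design_of_order_def graph_design_def disjoint_family_on_def down_link_def)
qed

theorem proposition3p2:
  fixes \<Gamma> :: "'a pair_pre_digraph" and \<Gamma>' :: "'b pair_pre_digraph" and v :: nat
  assumes "pair_graph \<Gamma>" and "pair_graph \<Gamma>'"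
    and "graph_le \<Gamma>' \<Gamma>" and "parcs \<Gamma>' \<noteq> {}"
    and "0 < v"
    and "\<exists>\<B> :: 'v::infinite pair_pre_digraph set. design_of_order v \<Gamma> \<B>"
  shows "L1 TYPE('v) \<Gamma>' \<Gamma> v \<noteq> {} \<and> L2 TYPE('v) \<Gamma>' \<Gamma> v \<noteq> {}"
proof -
  have "\<exists>n. \<forall>\<B> :: 'v pair_pre_digraph set. design_of_order v \<Gamma> \<B> \<longrightarrow>
      (\<exists>\<B>' f. design_of_order n \<Gamma>' \<B>' \<and> down_link f \<B> \<B>')"
  \<comment> \<open>With a single vertex there would be no edges to place, and \<open>m\<close>
    would be 0.\<close>
  proof (cases "v = 1")
    case True
    thus ?thesis using down_link_order_1 assms(3,4) by blast
  next
    case False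
    obtain p where "prime p" "p > v * (2 * 2 ^ v) ^ 2 * ((2 * 2 ^ v) ^ v) ^ 2" "2 * fact (2 ^ v) dvd p - 1"
      using exists_large_prime_cong_1[of "2 * fact (2 ^ v)"] by auto
    moreover have "v \<ge> 2" using False assms(5) by linarith
    ultimately show ?thesis using down_link_to_prime_order[OF assms(3,4)] by blast
  qed
  then obtain n where n: "n \<in> L2 TYPE('v) \<Gamma>' \<Gamma> v" unfolding L2_def by blast
  \<comment> \<open>Since some design of order \<open>v\<close> exists, \<open>L2\<close> is
    contained in \<open>L1\<close>.\<close>
  moreover from this have "n \<in> L1 TYPE('v) \<Gamma>' \<Gamma> v" using assms(6) unfolding L1_def L2_def by blast
  ultimately show ?thesis by blast
qed

end
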